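(* Let $T\in\mathcal{B}(\mathcal{H})$ and $T'\in\mathcal{B}(\mathcal{H}')$ be contractions. (i) If $T$ and $T'$ are quasisimilar, then $\gamma_T$ is injective if and only if $\gamma_{T'}$ is injective. (ii) $\gamma_{T\oplus T'}$ is injective if and only if $\gamma_T$ and $\gamma_{T'}$ are injective and $T$ is in stable relation with $T'$. (iii) $\gamma_{T\oplus T}$ is injective if and only if $\gamma_T$ is injective.
   Context: For a contraction $T$, $A_T$ is the strong-operator limit of $T^{*n}T^n$ and $\mathcal{H}_0(T)=\{x:\|T^nx\|\to0\}$. The commutant mapping $\gamma_T:\{T\}'\to\{W_T\}'$ sends $C$ to the unique $D$ commuting with $W_T$ such that $X_TC=DX_T$, where $X_Tx=A_T^{1/2}x$ maps into the space of $W_T$, and $W_T$ is the minimal unitary dilation of the unique isometry $V_T$ on $\overline{\operatorname{ran}A_T}$ with $A_T^{1/2}T=V_TA_T^{1/2}$. $\mathcal{I}(A,B)=\{X:XA=BX\}$. A quasiaffinity is an operator with trivial kernel and dense range; $T$ and $T'$ are quasisimilar if there exist quasiaffinities $X\in\mathcal{I}(T,T')$ and $Y\in\mathcal{I}(T',T)$. $T$ is in stable relation with $T'$ if $C\in\mathcal{I}(T,T')$ with $\operatorname{ran}C\subseteq\mathcal{H}'_0(T')$ implies $C=0$, and $C'\in\mathcal{I}(T',T)$ with $\operatorname{ran}C'\subseteq\mathcal{H}_0(T)$ implies $C'=0$. *)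

theory Defs
  imports "HOL-Analysis.Analysis"
begin

text \<open>HOL-Analysis only provides real inner product spaces. A complex Hilbert space is
encoded (equivalently) as its realification: a real Hilbert space (real_inner +
complete_space; real inner product = real part of the complex one) together with the
operator cJ of multiplication by the imaginary unit, an orthogonal linear map with
cJ o cJ = -id. Complex-linear bounded operators are exactly the real bounded linear
operators commuting with cJ.\<close>

class chilbert = real_inner + complete_space +
  fixes cJ :: "'a \<Rightarrow> 'a"
  assumes cJ_add: "cJ (x + y) = cJ x + cJ y"
    and cJ_scaleR: "cJ (r *\<^sub>R x) = r *\<^sub>R cJ x"
    and cJ_cJ: "cJ (cJ x) = - x"
    and cJ_inner: "inner (cJ x) (cJ y) = inner x y"

instantiation prod :: (chilbert, chilbert) chilbert
begin
definition cJ_prod :: "'a \<times> 'b \<Rightarrow> 'a \<times> 'b" where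
  "cJ_prod = (\<lambda>(x, y). (cJ x, cJ y))"
instance
  by standard (auto simp: cJ_prod_def cJ_cJ cJ_inner cJ_add cJ_scaleR inner_prod_def case_prod_beta)
end

text \<open>The zero Hilbert space (needed as a possible dilation space).\<close>

instantiation unit :: real_inner
begin
definition "zero_unit = ()"
definition "plus_unit (x::unit) (y::unit) = ()"
definition "scaleR_unit (r::real) (x::unit) = ()"
definition "norm_unit (x::unit) = (0::real)"
definition "sgn_unit (x::unit) = ()"
definition "dist_unit (x::unit) (y::unit) = (0::real)"
definition "uniformity_unit = (INF e\<in>{0 <..}. principal {(x::unit, y). dist x y < e})"
definition "open_unit (U :: unit set) = (\<forall>x\<in>U. \<forall>\<^sub>F (x', y) in uniformity. x' = x \<longrightarrow> y \<in> U)"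
definition "inner_unit (x::unit) (y::unit) = (0::real)"
instance
  by standard (auto simp: zero_unit_def plus_unit_def scaleR_unit_def norm_unit_def sgn_unit_def
    dist_unit_def uniformity_unit_def open_unit_def inner_unit_def)
end

instance unit :: complete_space
proof
  fix X :: "nat \<Rightarrow> unit"
  have "X = (\<lambda>_. ())" by auto
  then show "Cauchy X \<Longrightarrow> convergent X"
    by (auto simp: convergent_def)
qed

instantiation unit :: chilbert
begin
definition "cJ_unit (x::unit) = ()"
instance
  by standard (auto simp: cJ_unit_def inner_unit_def)
end

definition cblin :: "('a::chilbert \<Rightarrow> 'b::chilbert) \<Rightarrow> bool" where
  "cblin f \<longleftrightarrow> bounded_linear f \<and> (\<forall>x. f (cJ x) = cJ (f x))"

definition contraction :: "('a::chilbert \<Rightarrow> 'a) \<Rightarrow> bool" where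
  "contraction T \<longleftrightarrow> cblin T \<and> (\<forall>x. norm (T x) \<le> norm x)"

definition A_op :: "('a::chilbert \<Rightarrow> 'a) \<Rightarrow> 'a \<Rightarrow> 'a" where
  "A_op T x = lim (\<lambda>n. (adjoint T ^^ n) ((T ^^ n) x))"

definition H0 :: "('a::chilbert \<Rightarrow> 'a) \<Rightarrow> 'a set" where
  "H0 T = {x. (\<lambda>n. norm ((T ^^ n) x)) \<longlonglongrightarrow> 0}"

definition pos_sqrt :: "('a::chilbert \<Rightarrow> 'a) \<Rightarrow> 'a \<Rightarrow> 'a" where
  "pos_sqrt A = (THE S. bounded_linear S \<and> (\<forall>x y. inner (S x) y = inner x (S y))
                      \<and> (\<forall>x. 0 \<le> inner (S x) x) \<and> (\<forall>x. S (S x) = A x))"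

text \<open>(W, E) is a minimal unitary dilation of the isometry V acting on the subspace L:
W is a unitary on the dilation space (the whole type 'k), E identifies L isometrically
(and complex-linearly) with a subspace of 'k, W extends V (W o E = E o V on L), and
'k is the closed linear span of the sets W^(-n) E(L), n \<ge> 0.\<close>
definition min_unitary_dilation ::
  "('a::chilbert \<Rightarrow> 'a) \<Rightarrow> 'a set \<Rightarrow> ('k::chilbert \<Rightarrow> 'k) \<Rightarrow> ('a \<Rightarrow> 'k) \<Rightarrow> bool" where
  "min_unitary_dilation V L W E \<longleftrightarrow>
     cblin W \<and> (\<forall>x. norm (W x) = norm x) \<and> surj W \<and>
     cblin E \<and> (\<forall>x\<in>L. \<forall>y\<in>L. inner (E x) (E y) = inner x y) \<and>
     (\<forall>x\<in>L. W (E x) = E (V x)) \<and>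
     closure (span (\<Union>n. (inv W ^^ n) ` (E ` L))) = UNIV"

text \<open>The data (W, E) realize W_T for the contraction T: V_T is the unique isometry on
closure (ran A_T) with A_T^(1/2) T = V_T A_T^(1/2), and (W, E) is a minimal unitary
dilation of V_T.  X_T = E o A_T^(1/2).\<close>
definition W_T_dilation :: "('a::chilbert \<Rightarrow> 'a) \<Rightarrow> ('k::chilbert \<Rightarrow> 'k) \<Rightarrow> ('a \<Rightarrow> 'k) \<Rightarrow> bool" where
  "W_T_dilation T W E \<longleftrightarrow>
     (let L = closure (range (A_op T)); S = pos_sqrt (A_op T) in
      \<exists>V. (\<forall>x\<in>L. V x \<in> L) \<and> (\<forall>x\<in>L. norm (V x) = norm x) \<and>
          (\<forall>x\<in>L. \<forall>y\<in>L. \<forall>a b. V (a *\<^sub>R x + b *\<^sub>R y) = a *\<^sub>R V x + b *\<^sub>R V y) \<and>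
          (\<forall>x. S (T x) = V (S x)) \<and> min_unitary_dilation V L W E)"

definition X_T :: "('a::chilbert \<Rightarrow> 'a) \<Rightarrow> ('a \<Rightarrow> 'k::chilbert) \<Rightarrow> 'a \<Rightarrow> 'k" where
  "X_T T E = E \<circ> pos_sqrt (A_op T)"

definition commutant :: "('a::chilbert \<Rightarrow> 'a) \<Rightarrow> ('a \<Rightarrow> 'a) set" where
  "commutant T = {C. cblin C \<and> C \<circ> T = T \<circ> C}"

definition intertw :: "('a::chilbert \<Rightarrow> 'a) \<Rightarrow> ('b::chilbert \<Rightarrow> 'b) \<Rightarrow> ('a \<Rightarrow> 'b) set" where
  "intertw A B = {X. cblin X \<and> X \<circ> A = B \<circ> X}"

definition gamma :: "('a::chilbert \<Rightarrow> 'a) \<Rightarrow> ('k::chilbert \<Rightarrow> 'k) \<Rightarrow> ('a \<Rightarrow> 'k) \<Rightarrow> ('a \<Rightarrow> 'a) \<Rightarrow> 'k \<Rightarrow> 'k" where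
  "gamma T W E C = (THE D. D \<in> commutant W \<and> X_T T E \<circ> C = D \<circ> X_T T E)"

definition gamma_injective :: "('a::chilbert \<Rightarrow> 'a) \<Rightarrow> ('k::chilbert \<Rightarrow> 'k) \<Rightarrow> ('a \<Rightarrow> 'k) \<Rightarrow> bool" where
  "gamma_injective T W E \<longleftrightarrow> inj_on (gamma T W E) (commutant T)"

definition quasiaffinity :: "('a::chilbert \<Rightarrow> 'b::chilbert) \<Rightarrow> bool" where
  "quasiaffinity X \<longleftrightarrow> cblin X \<and> inj X \<and> closure (range X) = UNIV"

definition quasisimilar :: "('a::chilbert \<Rightarrow> 'a) \<Rightarrow> ('b::chilbert \<Rightarrow> 'b) \<Rightarrow> bool" where
  "quasisimilar T T' \<longleftrightarrow>
     (\<exists>X\<in>intertw T T'. \<exists>Y\<in>intertw T' T. quasiaffinity X \<and> quasiaffinity Y)"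

definition stable_relation :: "('a::chilbert \<Rightarrow> 'a) \<Rightarrow> ('b::chilbert \<Rightarrow> 'b) \<Rightarrow> bool" where
  "stable_relation T T' \<longleftrightarrow>
     (\<forall>C\<in>intertw T T'. range C \<subseteq> H0 T' \<longrightarrow> C = (\<lambda>_. 0)) \<and>
     (\<forall>C'\<in>intertw T' T. range C' \<subseteq> H0 T \<longrightarrow> C' = (\<lambda>_. 0))"

definition dsum :: "('a::chilbert \<Rightarrow> 'a) \<Rightarrow> ('b::chilbert \<Rightarrow> 'b) \<Rightarrow> 'a \<times> 'b \<Rightarrow> 'a \<times> 'b" where
  "dsum T T' = map_prod T T'"

end

theory Submission
  imports Defs
begin

text \<open>By the definition of the asymptotic limit, \<open>\<parallel>X\<^sub>T x\<parallel> = lim \<parallel>T\<^sup>n x\<parallel>\<close>, so the kernel of \<open>X\<^sub>T\<close> is the stable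
  subspace of \<open>T\<close>. If \<open>C\<close> commutes with \<open>T\<close>, this formula gives \<open>\<parallel>X\<^sub>T C x\<parallel> \<le> \<parallel>C\<parallel> \<parallel>X\<^sub>T x\<parallel>\<close>, hence
  \<open>W\<^sup>-\<^sup>n X\<^sub>T x \<mapsto> W\<^sup>-\<^sup>n X\<^sub>T C x\<close> is well defined and bounded on a dense subspace and extends to the only
  possible value of the commutant mapping at \<open>C\<close>. Consequently the commutant mapping is injective iff
  no nonzero operator commuting with \<open>T\<close> has its range in the stable subspace. This last
  condition passes through quasiaffinities, and for direct sums it decouples into conditions on the
  four matrix entries.\<close>

section \<open>Projections and adjoints in Hilbert spaces\<close>

text \<open>A sequence in \<open>M\<close> minimizing the distance to \<open>x\<close> is Cauchy by
  the parallelogram law. Its limit \<open>p\<close> is a nearest point, and comparing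
  \<open>p\<close> with \<open>p + t y\<close> forces orthogonality.\<close>

lemma orthogonal_projection_exists:
  fixes M :: "'a::{real_inner,complete_space} set"
  assumes "subspace M" "closed M"
  obtains p where "p \<in> M" "\<And>m. m \<in> M \<Longrightarrow> inner (x - p) m = 0"
proof -
  define d where "d = (INF m\<in>M. (norm (x - m))\<^sup>2)"
  have ne: "M \<noteq> {}"
    using subspace_0[OF assms(1)] by auto
  have bdd: "bdd_below ((\<lambda>m. (norm (x - m))\<^sup>2) ` M)"
    by (rule bdd_belowI[of _ 0]) auto
  have d_le: "d \<le> (norm (x - m))\<^sup>2" if "m \<in> M" for m
    unfolding d_def by (rule cINF_lower[OF bdd that])
  have "\<exists>m\<in>M. (norm (x - m))\<^sup>2 < d + 1 / (real n + 1)" for n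
    using cINF_less_iff[OF ne bdd, of "d + 1 / (real n + 1)"] unfolding d_def[symmetric] by simp
  then obtain m where m: "\<And>n. m n \<in> M" "\<And>n. (norm (x - m n))\<^sup>2 < d + 1 / (real n + 1)"
    by metis
  \<comment> \<open>Parallelogram law for \<open>x - m i\<close> and \<open>x - m j\<close>. The
    midpoint of \<open>m i\<close> and \<open>m j\<close> lies in \<open>M\<close>, so its squared
    distance to \<open>x\<close> is at least \<open>d\<close>, and only the two excesses over
    \<open>d\<close> survive.\<close>
  have par: "(norm (m i - m j))\<^sup>2 \<le> 2 / (real i + 1) + 2 / (real j + 1)" for i j
  proof -
    have "(norm (m i - m j))\<^sup>2 = 2 * (norm (x - m i))\<^sup>2 + 2 * (norm (x - m j))\<^sup>2
        - 4 * (norm (x - (1/2) *\<^sub>R (m i + m j)))\<^sup>2"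
      unfolding power2_norm_eq_inner by (simp add: inner_simps inner_commute algebra_simps)
    moreover have "(1/2) *\<^sub>R (m i + m j) \<in> M"
      using m assms(1) by (intro subspace_scale subspace_add)
    ultimately show ?thesis
      using d_le[of "(1/2) *\<^sub>R (m i + m j)"] m(2)[of i] m(2)[of j] by simp
  qed
  have "Cauchy m"
  proof (rule metric_CauchyI)
    fix e :: real assume "e > 0"
    obtain N :: nat where N: "4 / e\<^sup>2 < real N"
      using reals_Archimedean2 by blast
    have "dist (m i) (m j) < e" if "i \<ge> N" "j \<ge> N" for i j
    proof -
      have "2 / (real i + 1) \<le> 2 / (real N + 1)" "2 / (real j + 1) \<le> 2 / (real N + 1)"
        using that by (auto intro!: divide_left_mono)
      moreover have "4 / (real N + 1) < e\<^sup>2"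
      proof -
        have "4 / e\<^sup>2 < real N + 1" using N by simp
        then show ?thesis using \<open>e > 0\<close> by (simp add: field_simps)
      qed
      ultimately have "(norm (m i - m j))\<^sup>2 < e\<^sup>2"
        using par[of i j] by simp
      then show ?thesis
        using \<open>e > 0\<close> by (simp add: dist_norm power2_less_imp_less)
    qed
    then show "\<exists>M. \<forall>i\<ge>M. \<forall>j\<ge>M. dist (m i) (m j) < e" by blast
  qed
  then obtain p where p: "m \<longlonglongrightarrow> p"
    using Cauchy_convergent convergent_def by blast
  have pM: "p \<in> M"
    using closed_sequentially[OF assms(2)] m(1) p by blast
  have "(norm (x - p))\<^sup>2 \<le> d"
  proof (rule LIMSEQ_le)
    show "(\<lambda>n. (norm (x - m n))\<^sup>2) \<longlonglongrightarrow> (norm (x - p))\<^sup>2"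
      using p by (intro tendsto_intros)
    have "(\<lambda>n. d + 1 / (real n + 1)) \<longlonglongrightarrow> d + 0"
      using LIMSEQ_inverse_real_of_nat by (intro tendsto_intros) (simp add: inverse_eq_divide add.commute)
    then show "(\<lambda>n. d + 1 / (real n + 1)) \<longlonglongrightarrow> d" by simp
    show "\<exists>N. \<forall>n\<ge>N. (norm (x - m n))\<^sup>2 \<le> d + 1 / (real n + 1)"
      using m(2) less_imp_le by blast
  qed
  then have min: "(norm (x - p))\<^sup>2 \<le> (norm (x - y))\<^sup>2" if "y \<in> M" for y
    using d_le[OF that] by linarith
  have "inner (x - p) y = 0" if "y \<in> M" for y
  proof (cases "y = 0")
    case False
    \<comment> \<open>This \<open>t\<close> minimizes the squared norm of
      \<open>x - p - t y\<close>, a quadratic polynomial in \<open>t\<close>.\<close>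
    define t where "t = inner (x - p) y / inner y y"
    have yy: "inner y y > 0" using False by simp
    have "p + t *\<^sub>R y \<in> M"
      using pM that assms(1) by (intro subspace_scale subspace_add)
    from min[OF this] have "0 \<le> t\<^sup>2 * inner y y - 2 * t * inner (x - p) y"
      unfolding power2_norm_eq_inner
      by (simp add: inner_simps inner_commute algebra_simps power2_eq_square)
    also have "\<dots> = - (inner (x - p) y)\<^sup>2 / inner y y"
      using yy by (simp add: t_def power2_eq_square field_simps)
    finally have "(inner (x - p) y)\<^sup>2 \<le> 0"
      using yy by (simp add: field_simps)
    then show ?thesis by simp
  qed simp
  with pM show ?thesis using that by blast
qed

text \<open>If \<open>f\<close> is not zero, take \<open>w\<close> nonzero and orthogonal to the
  kernel of \<open>f\<close>. Then \<open>x - (f x / f w) w\<close> lies in the kernel, and pairing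
  it with \<open>w\<close> shows that \<open>f\<close> is the inner product with a multiple of
  \<open>w\<close>.\<close>

lemma Riesz_representation:
  fixes f :: "'a::{real_inner,complete_space} \<Rightarrow> real"
  assumes f: "bounded_linear f"
  obtains z where "\<And>x. f x = inner x z"
proof (cases "\<forall>x. f x = 0")
  case True
  then show ?thesis using that[of 0] by simp
next
  case False
  then obtain u where u: "f u \<noteq> 0" by blast
  interpret f: bounded_linear f by fact
  let ?M = "{x. f x = 0}"
  have sub: "subspace ?M"
    by (auto simp: subspace_def f.add f.scaleR f.zero)
  have "closed ?M"
    by (intro closed_Collect_eq continuous_intros f.continuous_on)
  from orthogonal_projection_exists[OF sub this, of u]
  obtain p where p: "f p = 0" "\<And>m. f m = 0 \<Longrightarrow> inner (u - p) m = 0" by auto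
  define w where "w = u - p"
  have fw: "f w = f u" by (simp add: w_def f.diff p(1))
  then have w0: "inner w w \<noteq> 0" using u f.zero by auto
  show ?thesis
  proof (rule that)
    fix x
    have "f (x - (f x / f w) *\<^sub>R w) = 0"
      using fw u by (simp add: f.diff f.scaleR)
    from p(2)[OF this] have "inner w x = f x / f w * inner w w"
      by (simp add: w_def[symmetric] inner_simps)
    then show "f x = inner x ((f w / inner w w) *\<^sub>R w)"
      using w0 u fw by (simp add: inner_commute field_simps)
  qed
qed

context
  fixes f :: "'a::{real_inner,complete_space} \<Rightarrow> 'b::real_inner"
  assumes f: "bounded_linear f"
begin

text \<open>\<open>adjoint\<close> is defined by choice, so its characteristic equation holds once
  some adjoint exists. Riesz representation of the functional sending \<open>x\<close> to
  \<open>inner (f x) y\<close> supplies one.\<close>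

lemma inner_adjoint_right: "inner (f x) y = inner x (adjoint f y)"
proof -
  have "\<exists>z. \<forall>x. inner (f x) y = inner x z" for y
    using Riesz_representation[OF bounded_linear_compose[OF bounded_linear_inner_left f]] by metis
  then have "\<exists>f'. \<forall>x y. inner (f x) y = inner x (f' y)" by metis
  from someI_ex[OF this] show ?thesis unfolding adjoint_def by blast
qed

lemma inner_adjoint_left: "inner (adjoint f y) x = inner y (f x)"
  unfolding inner_commute[of _ x] inner_commute[of y] inner_adjoint_right ..

lemma bounded_linear_adjoint: "bounded_linear (adjoint f)"
proof -
  obtain K where K: "K \<ge> 0" "\<And>x. norm (f x) \<le> norm x * K"
    using bounded_linear.nonneg_bounded[OF f] by blast
  show ?thesis
  proof (rule bounded_linear_intro)
    show "adjoint f (x + y) = adjoint f x + adjoint f y" for x y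
      by (rule vector_eq_rdot[THEN iffD1]) (simp add: inner_simps inner_adjoint_left)
    show "adjoint f (r *\<^sub>R x) = r *\<^sub>R adjoint f x" for r x
      by (rule vector_eq_rdot[THEN iffD1]) (simp add: inner_simps inner_adjoint_left)
    show "norm (adjoint f y) \<le> norm y * K" for y
    proof -
      have "(norm (adjoint f y))\<^sup>2 = inner y (f (adjoint f y))"
        by (simp add: power2_norm_eq_inner inner_adjoint_left)
      also have "\<dots> \<le> norm y * norm (f (adjoint f y))"
        by (rule norm_cauchy_schwarz)
      also have "\<dots> \<le> norm y * (norm (adjoint f y) * K)"
        by (intro mult_left_mono K) simp
      finally have "norm (adjoint f y) * norm (adjoint f y) \<le> norm (adjoint f y) * (norm y * K)"
        by (simp add: power2_eq_square algebra_simps)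
      then show ?thesis
        using K(1) by (cases "adjoint f y = 0") auto
    qed
  qed
qed

end

section \<open>Positive operators\<close>

text \<open>These are the requirements in \<open>pos_sqrt\<close> apart from the square. Symmetry is
  a separate clause because over the reals it does not follow from nonnegativity of the quadratic
  form.\<close>

definition pos_op :: "('a::real_inner \<Rightarrow> 'a) \<Rightarrow> bool" where
  "pos_op A \<longleftrightarrow> bounded_linear A \<and> (\<forall>x y. inner (A x) y = inner x (A y))
     \<and> (\<forall>x. 0 \<le> inner (A x) x)"

lemma pos_op_bounded_linear: "pos_op A \<Longrightarrow> bounded_linear A"
  and pos_op_symmetric: "pos_op A \<Longrightarrow> inner (A x) y = inner x (A y)"
  and pos_op_nonneg: "pos_op A \<Longrightarrow> 0 \<le> inner (A x) x"
  unfolding pos_op_def by blast+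

lemma pos_op_Cauchy_Schwarz:
  assumes A: "pos_op A"
  shows "(inner (A x) y)\<^sup>2 \<le> inner (A x) x * inner (A y) y"
proof -
  interpret bounded_linear A by (rule pos_op_bounded_linear[OF A])
  define a b c where "a = inner (A x) x" and "b = inner (A x) y" and "c = inner (A y) y"
  have b': "inner (A y) x = b"
    using pos_op_symmetric[OF A, of y x] by (simp add: b_def inner_commute)
  have q: "0 \<le> a + 2 * t * b + t\<^sup>2 * c" for t
    using pos_op_nonneg[OF A, of "x + t *\<^sub>R y"] b'
    by (simp add: add scaleR inner_simps a_def b_def c_def power2_eq_square algebra_simps)
  have c: "c \<ge> 0" unfolding c_def by (rule pos_op_nonneg[OF A])
  have "b\<^sup>2 \<le> a * c"
  proof (cases "c = 0")
    case True
    then have "b = 0"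
      \<comment> \<open>With \<open>c = 0\<close> the form is affine in \<open>t\<close>, and at
        this \<open>t\<close> it would take the value \<open>-1\<close>.\<close>
      using q[of "- (a + 1) / (2 * b)"] by (cases "b = 0") (simp_all add: field_simps)
    then show ?thesis using True by simp
  next
    case False
    have "0 \<le> a + 2 * (- b / c) * b + (- b / c)\<^sup>2 * c" by (rule q)
    also have "\<dots> = a - b\<^sup>2 / c"
      using False by (simp add: power2_eq_square field_simps)
    finally show ?thesis using c False by (simp add: field_simps)
  qed
  then show ?thesis by (simp add: a_def b_def c_def)
qed

lemma pos_op_eq_0:
  assumes "pos_op A" "inner (A x) x = 0"
  shows "A x = 0"
proof -
  have "(inner (A x) (A x))\<^sup>2 \<le> 0"
    using pos_op_Cauchy_Schwarz[OF assms(1), of x "A x"] unfolding assms(2) by simp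
  then show ?thesis by simp
qed

text \<open>Apply Cauchy-Schwarz for the form of \<open>A\<close> with \<open>y = A x\<close>, and
  bound the last factor by \<open>le\<close>. This estimate later turns convergence of quadratic
  forms into norm convergence of vectors.\<close>

lemma pos_op_norm_square_le:
  assumes A: "pos_op A" and le: "\<And>x. inner (A x) x \<le> inner x x"
  shows "(norm (A x))\<^sup>2 \<le> inner (A x) x"
proof (cases "A x = 0")
  case False
  have "(inner (A x) (A x))\<^sup>2 \<le> inner (A x) x * inner (A (A x)) (A x)"
    by (rule pos_op_Cauchy_Schwarz[OF A])
  also have "\<dots> \<le> inner (A x) x * inner (A x) (A x)"
    by (intro mult_left_mono le pos_op_nonneg[OF A])
  finally have "inner (A x) (A x) \<le> inner (A x) x"
    using False by (simp add: power2_eq_square)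
  then show ?thesis by (simp add: power2_norm_eq_inner)
qed simp

lemma pos_op_contractive:
  assumes A: "pos_op A" and le: "\<And>x. inner (A x) x \<le> inner x x"
  shows "norm (A x) \<le> norm x"
proof -
  have "(norm (A x))\<^sup>2 \<le> (norm x)\<^sup>2"
    using pos_op_norm_square_le[OF A le, of x] le[of x] by (simp add: power2_norm_eq_inner)
  then show ?thesis by (rule power2_le_imp_le) simp
qed

lemma bounded_linear_pointwise_limit:
  assumes F: "\<And>n::nat. bounded_linear (F n)" and K: "\<And>n x. norm (F n x) \<le> K * norm x"
    and lim: "\<And>x. (\<lambda>n. F n x) \<longlonglongrightarrow> G x"
  shows "bounded_linear G" and "norm (G x) \<le> K * norm x"
proof -
  have K': "norm (G x) \<le> K * norm x" for x
    by (rule LIMSEQ_le_const2[OF tendsto_norm[OF lim]]) (use K in auto)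
  show "bounded_linear G"
  proof (rule bounded_linear_intro)
    show "G (x + y) = G x + G y" for x y
      using LIMSEQ_unique[OF lim[of "x + y"]] tendsto_add[OF lim lim]
      by (simp add: linear_add bounded_linear.linear[OF F])
    show "G (r *\<^sub>R x) = r *\<^sub>R G x" for r x
      using LIMSEQ_unique[OF lim[of "r *\<^sub>R x"]] tendsto_scaleR[OF tendsto_const lim]
      by (simp add: linear_scale bounded_linear.linear[OF F])
    show "norm (G x) \<le> norm x * K" for x using K' by (simp add: mult.commute)
  qed
  show "norm (G x) \<le> K * norm x" by (rule K')
qed

section \<open>The positive square root\<close>

text \<open>With \<open>B = I - A\<close>, the limit \<open>Y\<close> of these iterates satisfies \<open>Y = (B + Y\<^sup>2) / 2\<close>, which says
  \<open>(I - Y)\<^sup>2 = A\<close>. The iterates for the scalar \<open>1\<close> majorize the increments.\<close>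

primrec sqrt_iter :: "('a::real_vector \<Rightarrow> 'a) \<Rightarrow> nat \<Rightarrow> 'a \<Rightarrow> 'a" where
  "sqrt_iter B 0 = (\<lambda>x. 0)"
| "sqrt_iter B (Suc n) = (\<lambda>x. (1/2) *\<^sub>R (B x + sqrt_iter B n (sqrt_iter B n x)))"

primrec sqrt_majorant :: "nat \<Rightarrow> real" where
  "sqrt_majorant 0 = 0"
| "sqrt_majorant (Suc n) = (1 + (sqrt_majorant n)\<^sup>2) / 2"

lemma sqrt_majorant_bounds: "0 \<le> sqrt_majorant n" "sqrt_majorant n \<le> 1"
proof -
  have "0 \<le> sqrt_majorant n \<and> sqrt_majorant n \<le> 1"
    by (induction n) (auto simp: power_le_one)
  then show "0 \<le> sqrt_majorant n" "sqrt_majorant n \<le> 1" by auto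
qed

lemma sqrt_majorant_incseq: "incseq sqrt_majorant"
proof (rule incseq_SucI)
  fix n
  \<comment> \<open>The increment of the majorant is half of this square.\<close>
  have "0 \<le> (sqrt_majorant n - 1)\<^sup>2" by simp
  then show "sqrt_majorant n \<le> sqrt_majorant (Suc n)"
    by (simp add: power2_eq_square algebra_simps)
qed

lemma Cauchy_sqrt_majorant: "Cauchy sqrt_majorant"
proof (rule convergent_Cauchy, rule Bseq_mono_convergent)
  show "Bseq sqrt_majorant"
    using sqrt_majorant_bounds by (intro BseqI'[of _ 1]) auto
qed (use sqrt_majorant_incseq in \<open>auto simp: incseq_def\<close>)

lemma sqrt_iter_commute:
  assumes "linear C" "\<And>x. C (B x) = B (C x)"
  shows "C (sqrt_iter B n x) = sqrt_iter B n (C x)"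
  using assms by (induction n arbitrary: x) (simp_all add: linear_0 linear_add linear_scale)

lemma sqrt_iter_symmetric:
  fixes B :: "'a::real_inner \<Rightarrow> 'a"
  assumes "\<And>x y. inner (B x) y = inner x (B y)"
  shows "inner (sqrt_iter B n x) y = inner x (sqrt_iter B n y)"
  using assms by (induction n arbitrary: x y) (simp_all add: inner_simps)

context
  fixes B :: "'a::real_normed_vector \<Rightarrow> 'a"
  assumes B: "bounded_linear B" and B_le: "\<And>x. norm (B x) \<le> norm x"
begin

lemma sqrt_iter_bounded_linear: "bounded_linear (sqrt_iter B n)"
proof (induction n)
  case 0
  then show ?case by (simp add: bounded_linear_zero)
next
  case (Suc n)
  show ?case
    unfolding sqrt_iter.simps
    by (intro bounded_linear_compose[OF bounded_linear_scaleR_right] bounded_linear_add B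
        bounded_linear_compose[OF Suc Suc])
qed

lemma norm_sqrt_iter_le: "norm (sqrt_iter B n x) \<le> sqrt_majorant n * norm x"
proof (induction n arbitrary: x)
  case (Suc n)
  have "norm (sqrt_iter B n (sqrt_iter B n x)) \<le> sqrt_majorant n * norm (sqrt_iter B n x)"
    by (rule Suc)
  also have "\<dots> \<le> sqrt_majorant n * (sqrt_majorant n * norm x)"
    by (intro mult_left_mono Suc sqrt_majorant_bounds)
  finally have "norm (B x + sqrt_iter B n (sqrt_iter B n x))
      \<le> norm x + (sqrt_majorant n)\<^sup>2 * norm x"
    using norm_triangle_le add_mono B_le[of x] by (metis power2_eq_square mult.assoc)
  then show ?case by (simp add: ring_distribs del: scaleR_add_right)
qed simp

text \<open>The operator identity \<open>P P - Q Q = P (P - Q) + (P - Q) Q\<close> mirrors the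
  scalar factorization of \<open>p^2 - q^2\<close>, so the induction for operators follows the
  recursion of the majorant term by term.\<close>

lemma norm_sqrt_iter_Suc_diff_le:
  "norm (sqrt_iter B (Suc n) x - sqrt_iter B n x)
     \<le> (sqrt_majorant (Suc n) - sqrt_majorant n) * norm x"
proof (induction n arbitrary: x)
  case 0
  then show ?case using B_le[of x] by simp
next
  case (Suc n)
  define P Q p q where "P = sqrt_iter B (Suc n)" and "Q = sqrt_iter B n"
    and "p = sqrt_majorant (Suc n)" and "q = sqrt_majorant n"
  interpret P: bounded_linear P unfolding P_def by (rule sqrt_iter_bounded_linear)
  have IH: "norm (P x - Q x) \<le> (p - q) * norm x" for x
    unfolding P_def Q_def p_def q_def by (rule Suc)
  have pq: "0 \<le> p" "0 \<le> q" "q \<le> p"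
    unfolding p_def q_def
    using sqrt_majorant_bounds sqrt_majorant_incseq by (auto simp: incseq_SucD simp del: sqrt_majorant.simps)
  have "P (P x) - Q (Q x) = P (P x - Q x) + (P (Q x) - Q (Q x))"
    by (simp add: P.diff)
  also have "norm \<dots> \<le> p * norm (P x - Q x) + (p - q) * norm (Q x)"
    using norm_sqrt_iter_le[of "Suc n", folded P_def p_def] IH by (intro norm_triangle_le add_mono)
  also have "\<dots> \<le> p * ((p - q) * norm x) + (p - q) * (q * norm x)"
    using IH norm_sqrt_iter_le[of n, folded Q_def q_def] pq by (intro add_mono mult_left_mono) auto
  also have "\<dots> = (p\<^sup>2 - q\<^sup>2) * norm x"
    by (simp add: power2_eq_square algebra_simps)
  finally have *: "norm (P (P x) - Q (Q x)) \<le> (p\<^sup>2 - q\<^sup>2) * norm x" .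
  have "sqrt_iter B (Suc (Suc n)) x - sqrt_iter B (Suc n) x = (1/2) *\<^sub>R (P (P x) - Q (Q x))"
    unfolding sqrt_iter.simps(2)[of B "Suc n"] unfolding P_def[symmetric]
    by (simp add: P_def Q_def algebra_simps)
  moreover have inc: "sqrt_majorant (Suc (Suc n)) - sqrt_majorant (Suc n) = (p\<^sup>2 - q\<^sup>2) / 2"
    unfolding sqrt_majorant.simps(2)[of "Suc n"] unfolding p_def[symmetric]
    by (simp add: p_def q_def field_simps)
  ultimately show ?case using * unfolding inc by (simp del: sqrt_iter.simps sqrt_majorant.simps)
qed

lemma norm_sqrt_iter_diff_le:
  "m \<le> n \<Longrightarrow> norm (sqrt_iter B n x - sqrt_iter B m x) \<le> (sqrt_majorant n - sqrt_majorant m) * norm x"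
proof (induction n rule: dec_induct)
  case (step n)
  have "norm (sqrt_iter B (Suc n) x - sqrt_iter B m x)
      \<le> norm (sqrt_iter B (Suc n) x - sqrt_iter B n x) + norm (sqrt_iter B n x - sqrt_iter B m x)"
    using norm_triangle_ineq[of "sqrt_iter B (Suc n) x - sqrt_iter B n x"] by (metis diff_add_cancel add_diff_eq)
  also have "\<dots> \<le> (sqrt_majorant (Suc n) - sqrt_majorant n) * norm x
      + (sqrt_majorant n - sqrt_majorant m) * norm x"
    by (intro add_mono norm_sqrt_iter_Suc_diff_le step.IH)
  finally show ?case by (simp add: algebra_simps del: sqrt_iter.simps sqrt_majorant.simps)
qed simp

lemma Cauchy_sqrt_iter: "Cauchy (\<lambda>n. sqrt_iter B n x)"
proof (rule CauchyI')
  fix e :: real assume "e > 0"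
  \<comment> \<open>The added 1 keeps the denominator positive when \<open>x = 0\<close>.\<close>
  then have "e / (norm x + 1) > 0" by (simp add: add_nonneg_pos)
  from CauchyD[OF Cauchy_sqrt_majorant this] obtain N where
    N: "\<And>m n. m \<ge> N \<Longrightarrow> n \<ge> N \<Longrightarrow> norm (sqrt_majorant m - sqrt_majorant n) < e / (norm x + 1)"
    by blast
  have "norm (sqrt_iter B m x - sqrt_iter B n x) < e" if "N \<le> m" "m < n" for m n
  proof -
    have "norm (sqrt_iter B m x - sqrt_iter B n x) \<le> (sqrt_majorant n - sqrt_majorant m) * norm x"
      using norm_sqrt_iter_diff_le[of m n x] that by (simp add: norm_minus_commute)
    also have "\<dots> \<le> e / (norm x + 1) * norm x"
      using N[of n m] that by (intro mult_right_mono) auto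
    also have "\<dots> < e"
      using \<open>e > 0\<close> by (simp add: pos_divide_less_eq add_nonneg_pos)
    finally show ?thesis .
  qed
  then show "\<exists>M. \<forall>m\<ge>M. \<forall>n>m. dist (sqrt_iter B m x) (sqrt_iter B n x) < e"
    unfolding dist_norm by blast
qed

end

text \<open>The root is \<open>S = I - Y\<close>, positive because \<open>Y\<close> is a symmetric
  contraction. The iterates are polynomials in \<open>I - A\<close>, so whatever commutes with
  \<open>A\<close> commutes with them and, by continuity, with \<open>S\<close>.\<close>

lemma pos_op_sqrt_exists:
  fixes A :: "'a::{real_inner,complete_space} \<Rightarrow> 'a"
  assumes A: "pos_op A" and le: "\<And>x. inner (A x) x \<le> inner x x"
  obtains S where "pos_op S" "\<And>x. S (S x) = A x"
    "\<And>C x. bounded_linear C \<Longrightarrow> (\<And>x. C (A x) = A (C x)) \<Longrightarrow> C (S x) = S (C x)"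
proof -
  interpret A: bounded_linear A by (rule pos_op_bounded_linear[OF A])
  define B where "B = (\<lambda>x. x - A x)"
  have B: "bounded_linear B"
    unfolding B_def by (intro bounded_linear_sub bounded_linear_ident A.bounded_linear_axioms)
  have Bsym: "inner (B x) y = inner x (B y)" for x y
    by (simp add: B_def inner_simps pos_op_symmetric[OF A])
  have "pos_op B"
    using B Bsym le by (simp add: pos_op_def B_def inner_simps)
  then have B_le: "norm (B x) \<le> norm x" for x
    using pos_op_nonneg[OF A] by (intro pos_op_contractive) (simp_all add: B_def inner_simps)
  define Y where "Y = (\<lambda>x. lim (\<lambda>n. sqrt_iter B n x))"
  have lim: "(\<lambda>n. sqrt_iter B n x) \<longlonglongrightarrow> Y x" for x
    using Cauchy_sqrt_iter[OF B B_le] by (simp add: Y_def Cauchy_convergent convergent_LIMSEQ_iff[symmetric])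
  have bd: "norm (sqrt_iter B n x) \<le> 1 * norm x" for n x
    using norm_sqrt_iter_le[OF B B_le, of n x] sqrt_majorant_bounds(2)[of n]
    by (meson mult_right_mono norm_ge_zero order_trans)
  note Y = bounded_linear_pointwise_limit[OF sqrt_iter_bounded_linear[OF B B_le] bd lim]
  interpret Y: bounded_linear Y by (rule Y(1))
  have YY: "(\<lambda>n. sqrt_iter B n (sqrt_iter B n x)) \<longlonglongrightarrow> Y (Y x)" for x
  proof -
    \<comment> \<open>Split the iterated value into this term and
      \<open>sqrt_iter B n (Y x)\<close>. The uniform bound 1 on the iterates makes this term vanish
      in the limit.\<close>
    have "(\<lambda>n. sqrt_iter B n (sqrt_iter B n x - Y x)) \<longlonglongrightarrow> 0"
    proof (rule tendsto_norm_zero_cancel, rule tendsto_sandwich[OF _ _ tendsto_const])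
      show "(\<lambda>n. norm (sqrt_iter B n x - Y x)) \<longlonglongrightarrow> 0"
        using lim[of x] by (simp add: LIM_zero tendsto_norm_zero)
    qed (use bd in auto)
    from tendsto_add[OF this lim[of "Y x"]] show ?thesis
      by (simp add: bounded_linear.linear[OF sqrt_iter_bounded_linear[OF B B_le]] linear_diff)
  qed
  have fix_eq: "Y x = (1/2) *\<^sub>R (B x + Y (Y x))" for x
  proof (rule LIMSEQ_unique)
    show "(\<lambda>n. sqrt_iter B (Suc n) x) \<longlonglongrightarrow> Y x"
      using LIMSEQ_Suc[OF lim[of x]] .
    show "(\<lambda>n. sqrt_iter B (Suc n) x) \<longlonglongrightarrow> (1/2) *\<^sub>R (B x + Y (Y x))"
      unfolding sqrt_iter.simps by (intro tendsto_intros YY)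
  qed
  define S where "S = (\<lambda>x. x - Y x)"
  have Ysym: "inner (Y x) y = inner x (Y y)" for x y
  proof (rule LIMSEQ_unique)
    show "(\<lambda>n. inner (sqrt_iter B n x) y) \<longlonglongrightarrow> inner (Y x) y"
      by (intro tendsto_intros lim)
    show "(\<lambda>n. inner (sqrt_iter B n x) y) \<longlonglongrightarrow> inner x (Y y)"
      unfolding sqrt_iter_symmetric[OF Bsym] by (intro tendsto_intros lim)
  qed
  have Ypos: "inner (Y x) x \<le> inner x x" for x
  proof -
    have "inner (Y x) x \<le> norm (Y x) * norm x" by (rule norm_cauchy_schwarz)
    also have "\<dots> \<le> norm x * norm x" using Y(2)[of x] by (intro mult_right_mono) auto
    finally show ?thesis by (simp add: norm_eq_sqrt_inner)
  qed
  show ?thesis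
  proof
    show "pos_op S"
      unfolding pos_op_def S_def using Ysym Ypos
      by (auto simp: inner_simps intro!: bounded_linear_sub bounded_linear_ident Y(1))
    show "S (S x) = A x" for x
    proof -
      have "2 *\<^sub>R Y x = x - A x + Y (Y x)"
        using arg_cong[OF fix_eq[of x], of "\<lambda>y. 2 *\<^sub>R y"] by (simp add: B_def)
      then show ?thesis by (simp add: S_def Y.diff scaleR_2 algebra_simps)
    qed
    show "C (S x) = S (C x)" if C: "bounded_linear C" and CA: "\<And>x. C (A x) = A (C x)" for C x
    proof -
      interpret C: bounded_linear C by fact
      have CB: "C (B x) = B (C x)" for x by (simp add: B_def C.diff CA)
      have "C (Y x) = Y (C x)"
      proof (rule LIMSEQ_unique)
        show "(\<lambda>n. C (sqrt_iter B n x)) \<longlonglongrightarrow> C (Y x)"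
          by (rule C.tendsto[OF lim])
        show "(\<lambda>n. C (sqrt_iter B n x)) \<longlonglongrightarrow> Y (C x)"
          unfolding sqrt_iter_commute[where C = C and B = B, OF C.linear CB] by (rule lim)
      qed
      then show ?thesis by (simp add: S_def C.diff)
    qed
  qed
qed

text \<open>For \<open>d = S x - R x\<close> commutation gives \<open>S d + R d = 0\<close>. Both
  forms are nonnegative, hence vanish at \<open>d\<close>, so \<open>S d = R d = 0\<close>. Moving
  \<open>S - R\<close> across the inner product then gives \<open>inner d d = 0\<close>.\<close>

lemma pos_op_sqrt_unique:
  assumes S: "pos_op S" and R: "pos_op R" and eq: "\<And>x. S (S x) = R (R x)"
    and comm: "\<And>x. R (S x) = S (R x)"
  shows "S = R"
proof
  fix x
  interpret S: bounded_linear S by (rule pos_op_bounded_linear[OF S])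
  interpret R: bounded_linear R by (rule pos_op_bounded_linear[OF R])
  define d where "d = S x - R x"
  have "S d + R d = 0"
    by (simp add: d_def S.diff R.diff eq comm)
  then have "inner (S d) d + inner (R d) d = 0"
    by (metis inner_add_left inner_zero_left)
  then have "inner (S d) d = 0" "inner (R d) d = 0"
    using pos_op_nonneg[OF S, of d] pos_op_nonneg[OF R, of d] by auto
  then have "S d = 0" "R d = 0"
    using pos_op_eq_0 S R by auto
  then have "inner (S x - R x) d = 0"
    by (simp add: inner_diff_left pos_op_symmetric[OF S] pos_op_symmetric[OF R])
  then show "S x = R x" by (simp add: d_def)
qed

text \<open>Any competitor \<open>R\<close> commutes with its own square \<open>A\<close>, hence
  with the constructed root. Uniqueness among commuting roots therefore settles the definite
  description.\<close>

lemma pos_sqrt_properties: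
  fixes A :: "'a::chilbert \<Rightarrow> 'a"
  assumes A: "pos_op A" and le: "\<And>x. inner (A x) x \<le> inner x x"
  shows "pos_op (pos_sqrt A)" and "pos_sqrt A (pos_sqrt A x) = A x"
    and "bounded_linear C \<Longrightarrow> (\<And>x. C (A x) = A (C x)) \<Longrightarrow> C (pos_sqrt A x) = pos_sqrt A (C x)"
proof -
  obtain S where S: "pos_op S" "\<And>x. S (S x) = A x"
    "\<And>C x. bounded_linear C \<Longrightarrow> (\<And>x. C (A x) = A (C x)) \<Longrightarrow> C (S x) = S (C x)"
    using pos_op_sqrt_exists[OF A le] by blast
  have "pos_sqrt A = S"
    unfolding pos_sqrt_def
  proof (rule the_equality)
    fix R assume R: "bounded_linear R \<and> (\<forall>x y. inner (R x) y = inner x (R y))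
      \<and> (\<forall>x. 0 \<le> inner (R x) x) \<and> (\<forall>x. R (R x) = A x)"
    then have "R (A x) = A (R x)" for x by metis
    then have "R (S x) = S (R x)" for x using R S(3) by blast
    then show "R = S"
      using pos_op_sqrt_unique[OF S(1), of R] R S(2) unfolding pos_op_def by metis
  qed (use S in \<open>auto simp: pos_op_def\<close>)
  with S show "pos_op (pos_sqrt A)" and "pos_sqrt A (pos_sqrt A x) = A x"
    and "bounded_linear C \<Longrightarrow> (\<And>x. C (A x) = A (C x)) \<Longrightarrow> C (pos_sqrt A x) = pos_sqrt A (C x)"
    by auto
qed

section \<open>Closed subspaces and the range of a positive root\<close>

lemma subspace_closure:
  fixes M :: "'a::real_normed_vector set"
  assumes M: "subspace M"
  shows "subspace (closure M)"
proof (rule subspaceI)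
  show "0 \<in> closure M"
    using subspace_0[OF M] closure_subset by blast
  show "x + y \<in> closure M" if xy: "x \<in> closure M" "y \<in> closure M" for x y
  proof -
    obtain f g where "\<And>n. f n \<in> M" "f \<longlonglongrightarrow> x" "\<And>n. g n \<in> M" "g \<longlonglongrightarrow> y"
      using xy unfolding closure_sequential by blast
    then have "\<forall>n. f n + g n \<in> M" "(\<lambda>n. f n + g n) \<longlonglongrightarrow> x + y"
      using subspace_add[OF M] tendsto_add by blast+
    then show ?thesis unfolding closure_sequential by (intro exI conjI)
  qed
  show "c *\<^sub>R x \<in> closure M" if x: "x \<in> closure M" for c x
  proof -
    obtain f where "\<And>n. f n \<in> M" "f \<longlonglongrightarrow> x"
      using x unfolding closure_sequential by blast
    then have "\<forall>n. c *\<^sub>R f n \<in> M" "(\<lambda>n. c *\<^sub>R f n) \<longlonglongrightarrow> c *\<^sub>R x"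
      using subspace_scale[OF M] tendsto_scaleR[OF tendsto_const] by blast+
    then show ?thesis unfolding closure_sequential by (intro exI conjI)
  qed
qed

text \<open>The range of the root lies in the orthogonal complement of the kernel of the square.\<close>

lemma pos_op_range_subset_closure_range_square:
  fixes S :: "'a::{real_inner,complete_space} \<Rightarrow> 'a"
  assumes S: "pos_op S"
  shows "S x \<in> closure (range (\<lambda>x. S (S x)))"
proof -
  interpret S: bounded_linear S by (rule pos_op_bounded_linear[OF S])
  let ?M = "closure (range (\<lambda>x. S (S x)))"
  have "subspace (range (\<lambda>x. S (S x)))"
    using linear_subspace_image[OF linear_compose[OF S.linear S.linear] subspace_UNIV]
    by (simp add: o_def)
  then have "subspace ?M" by (rule subspace_closure)
  from orthogonal_projection_exists[OF this closed_closure, of "S x"]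
  obtain p where p: "p \<in> ?M" "\<And>m. m \<in> ?M \<Longrightarrow> inner (S x - p) m = 0" by blast
  define w where "w = S x - p"
  \<comment> \<open>The left side is the squared norm of \<open>S w\<close>.\<close>
  have "inner w (S (S w)) = 0"
    unfolding w_def by (intro p(2) subsetD[OF closure_subset]) blast
  then have "S w = 0"
    using pos_op_symmetric[OF S, of w "S w"] by simp
  then have "inner w (S x) = 0"
    using pos_op_symmetric[OF S, of w x] by simp
  moreover have "inner w p = 0" unfolding w_def by (intro p)
  ultimately have "inner w w = 0" by (simp add: w_def inner_diff_right inner_diff_left)
  then show ?thesis using p(1) by (simp add: w_def)
qed

section \<open>The asymptotic limit of a contraction\<close>

lemma cblinD:
  assumes "cblin f"
  shows "bounded_linear f" "f (cJ x) = cJ (f x)"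
  using assms by (auto simp: cblin_def)

lemma contractionD:
  assumes "contraction T"
  shows "cblin T" "bounded_linear T" "norm (T x) \<le> norm x"
  using assms by (auto simp: contraction_def cblin_def)

lemma contraction_0: "contraction T \<Longrightarrow> T 0 = 0"
  by (simp add: contractionD(2) bounded_linear.linear linear_0)

lemma norm_cJ: "norm (cJ x) = norm x"
  by (simp add: norm_eq_sqrt_inner cJ_inner)

lemma inner_cJ_left: "inner (cJ x) y = - inner x (cJ y)"
  using cJ_inner[of "cJ x" y] by (simp add: cJ_cJ)

lemma bounded_linear_cJ: "bounded_linear cJ"
  by (rule bounded_linear_intro[of _ 1]) (auto simp: cJ_add cJ_scaleR norm_cJ)

lemmas cJ_diff = linear_diff[OF bounded_linear.linear[OF bounded_linear_cJ]]
  and cJ_0 = linear_0[OF bounded_linear.linear[OF bounded_linear_cJ]]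

lemma cblin_compose: "cblin f \<Longrightarrow> cblin g \<Longrightarrow> cblin (\<lambda>x. f (g x))"
  by (auto simp: cblin_def bounded_linear_compose)

lemma bounded_linear_funpow:
  fixes f :: "'a::real_normed_vector \<Rightarrow> 'a"
  assumes "bounded_linear f"
  shows "bounded_linear (f ^^ n)"
proof (induction n)
  case 0
  then show ?case by (simp add: id_def bounded_linear_ident)
next
  case (Suc n)
  then show ?case by (simp add: o_def bounded_linear_compose[OF assms])
qed

lemma funpow_cJ:
  fixes f :: "'a::chilbert \<Rightarrow> 'a"
  assumes "\<And>x. f (cJ x) = cJ (f x)"
  shows "(f ^^ n) (cJ x) = cJ ((f ^^ n) x)"
  by (induction n) (simp_all add: assms)

lemma norm_funpow_le:
  assumes "contraction T"
  shows "norm ((T ^^ n) x) \<le> norm x"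
  by (induction n) (auto intro: order_trans[OF contractionD(3)[OF assms]])

lemma decseq_norm_funpow:
  assumes "contraction T"
  shows "decseq (\<lambda>n. norm ((T ^^ n) x))"
  by (rule decseq_SucI) (simp add: contractionD(3)[OF assms])

lemma inner_adjoint_funpow:
  fixes f :: "'a::{real_inner,complete_space} \<Rightarrow> 'a"
  assumes "bounded_linear f"
  shows "inner ((adjoint f ^^ n) x) y = inner x ((f ^^ n) y)"
proof (induction n arbitrary: y)
  case (Suc n)
  have "inner ((adjoint f ^^ Suc n) x) y = inner x ((f ^^ n) (f y))"
    by (simp add: inner_adjoint_left[OF assms] Suc)
  then show ?case by (simp add: funpow_swap1)
qed simp

context
  fixes T :: "'a::chilbert \<Rightarrow> 'a"
  assumes T: "contraction T"
begin

text \<open>The quadratic form of the difference is the drop of the squared norm of the orbit of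
  \<open>x\<close> from step \<open>m\<close> to step \<open>n\<close>, which is nonnegative for a
  contraction.\<close>

lemma pos_op_asymptotic_diff:
  assumes "m \<le> n"
  shows "pos_op (\<lambda>x. (adjoint T ^^ m) ((T ^^ m) x) - (adjoint T ^^ n) ((T ^^ n) x))"
  unfolding pos_op_def
proof (intro conjI allI)
  show "bounded_linear (\<lambda>x. (adjoint T ^^ m) ((T ^^ m) x) - (adjoint T ^^ n) ((T ^^ n) x))"
    by (intro bounded_linear_sub bounded_linear_compose[OF bounded_linear_funpow bounded_linear_funpow]
        bounded_linear_adjoint contractionD[OF T])
  show "inner ((adjoint T ^^ m) ((T ^^ m) x) - (adjoint T ^^ n) ((T ^^ n) x)) y
      = inner x ((adjoint T ^^ m) ((T ^^ m) y) - (adjoint T ^^ n) ((T ^^ n) y))" for x y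
    using inner_adjoint_funpow[OF contractionD(2)[OF T]]
    by (simp add: inner_diff_left inner_diff_right) (metis inner_commute)
  have "(norm ((T ^^ n) x))\<^sup>2 \<le> (norm ((T ^^ m) x))\<^sup>2" for x
    using decseqD[OF decseq_norm_funpow[OF T] assms] by (intro power_mono) auto
  then show "0 \<le> inner ((adjoint T ^^ m) ((T ^^ m) x) - (adjoint T ^^ n) ((T ^^ n) x)) x" for x
    by (simp add: inner_diff_left inner_adjoint_funpow[OF contractionD(2)[OF T]] power2_norm_eq_inner)
qed

text \<open>The difference lies between 0 and the identity, so \<open>pos_op_norm_square_le\<close>
  bounds its squared norm by its quadratic form.\<close>

lemma norm_asymptotic_diff_le:
  assumes "m \<le> n"
  shows "(norm ((adjoint T ^^ m) ((T ^^ m) x) - (adjoint T ^^ n) ((T ^^ n) x)))\<^sup>2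
    \<le> (norm ((T ^^ m) x))\<^sup>2 - (norm ((T ^^ n) x))\<^sup>2"
proof -
  have eq: "inner ((adjoint T ^^ m) ((T ^^ m) x) - (adjoint T ^^ n) ((T ^^ n) x)) x
      = (norm ((T ^^ m) x))\<^sup>2 - (norm ((T ^^ n) x))\<^sup>2" for x
    by (simp add: inner_diff_left inner_adjoint_funpow[OF contractionD(2)[OF T]] power2_norm_eq_inner)
  have "(norm ((T ^^ m) x))\<^sup>2 - (norm ((T ^^ n) x))\<^sup>2 \<le> inner x x" for x
    using power_mono[OF norm_funpow_le[OF T, of m x] norm_ge_zero, of 2]
    by (simp add: power2_norm_eq_inner[of x, symmetric] add.commute add_increasing2 diff_le_eq)
  then show ?thesis
    using pos_op_norm_square_le[OF pos_op_asymptotic_diff[OF assms], of x] unfolding eq by blast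
qed

text \<open>The squared orbit norms decrease and are bounded below, hence form a Cauchy sequence;
  the preceding estimate transfers this to the vectors. So the \<open>lim\<close> in
  \<open>A_op\<close> is a genuine limit.\<close>

lemma A_op_limit: "(\<lambda>n. (adjoint T ^^ n) ((T ^^ n) x)) \<longlonglongrightarrow> A_op T x"
proof -
  have "convergent (\<lambda>n. norm ((T ^^ n) x))"
    using decseq_convergent[OF decseq_norm_funpow[OF T], of 0 x] by (auto simp: convergent_def)
  then have "convergent (\<lambda>n. (norm ((T ^^ n) x))\<^sup>2)"
    unfolding convergent_def using tendsto_power by blast
  then have C: "Cauchy (\<lambda>n. (norm ((T ^^ n) x))\<^sup>2)"
    by (rule convergent_Cauchy)
  have "Cauchy (\<lambda>n. (adjoint T ^^ n) ((T ^^ n) x))"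
  proof (rule CauchyI')
    fix e :: real assume "e > 0"
    then have "e\<^sup>2 > 0" by simp
    from CauchyD[OF C this] obtain N where
      N: "\<And>m n. m \<ge> N \<Longrightarrow> n \<ge> N \<Longrightarrow> norm ((norm ((T ^^ m) x))\<^sup>2 - (norm ((T ^^ n) x))\<^sup>2) < e\<^sup>2"
      by blast
    have "norm ((adjoint T ^^ m) ((T ^^ m) x) - (adjoint T ^^ n) ((T ^^ n) x)) < e"
      if "N \<le> m" "m < n" for m n
    proof (rule power2_less_imp_less)
      show "(norm ((adjoint T ^^ m) ((T ^^ m) x) - (adjoint T ^^ n) ((T ^^ n) x)))\<^sup>2 < e\<^sup>2"
        using norm_asymptotic_diff_le[of m n x] N[of m n] that by simp
    qed (use \<open>e > 0\<close> in simp)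
    then show "\<exists>M. \<forall>m\<ge>M. \<forall>n>m.
        dist ((adjoint T ^^ m) ((T ^^ m) x)) ((adjoint T ^^ n) ((T ^^ n) x)) < e"
      unfolding dist_norm by blast
  qed
  then show ?thesis
    by (simp add: A_op_def Cauchy_convergent convergent_LIMSEQ_iff[symmetric])
qed

lemma inner_funpow_limit:
  "(\<lambda>n. inner ((T ^^ n) x) ((T ^^ n) y)) \<longlonglongrightarrow> inner (A_op T x) y"
  using tendsto_inner[OF A_op_limit tendsto_const, of x y]
  by (simp add: inner_adjoint_funpow[OF contractionD(2)[OF T]])

lemma A_op_le: "inner (A_op T x) x \<le> inner x x"
proof (rule LIMSEQ_le_const2[OF inner_funpow_limit])
  show "\<exists>N. \<forall>n\<ge>N. inner ((T ^^ n) x) ((T ^^ n) x) \<le> inner x x"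
    using power_mono[OF norm_funpow_le[OF T] norm_ge_zero, of _ x 2]
    by (simp add: power2_norm_eq_inner)
qed

lemma pos_op_A_op: "pos_op (A_op T)"
  unfolding pos_op_def
proof (intro conjI allI)
  have bd: "norm ((adjoint T ^^ n) ((T ^^ n) x)) \<le> 1 * norm x" for n x
  proof -
    define z where "z = (adjoint T ^^ n) ((T ^^ n) x)"
    have "(norm z)\<^sup>2 = inner ((T ^^ n) x) ((T ^^ n) z)"
      by (simp add: z_def power2_norm_eq_inner inner_adjoint_funpow[OF contractionD(2)[OF T]])
    also have "\<dots> \<le> norm ((T ^^ n) x) * norm ((T ^^ n) z)" by (rule norm_cauchy_schwarz)
    also have "\<dots> \<le> norm x * norm z"
      by (intro mult_mono norm_funpow_le[OF T]) auto
    finally have "norm z * norm z \<le> norm x * norm z" by (simp add: power2_eq_square)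
    then show ?thesis by (cases "z = 0") (auto simp flip: z_def)
  qed
  show "bounded_linear (A_op T)"
    by (rule bounded_linear_pointwise_limit(1)[OF _ bd A_op_limit])
      (intro bounded_linear_compose[OF bounded_linear_funpow bounded_linear_funpow]
        bounded_linear_adjoint contractionD[OF T])
  show "inner (A_op T x) y = inner x (A_op T y)" for x y
    using LIMSEQ_unique[OF inner_funpow_limit[of x y]] inner_funpow_limit[of y x]
    by (simp add: inner_commute)
  show "0 \<le> inner (A_op T x) x" for x
    by (rule LIMSEQ_le_const[OF inner_funpow_limit]) auto
qed

text \<open>\<open>cJ\<close> is skew-adjoint for the real inner product and commutes with
  \<open>T\<close>, so it can be moved across the form that defines \<open>A_op T\<close> in the
  limit.\<close>

lemma A_op_cJ: "A_op T (cJ x) = cJ (A_op T x)"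
proof (rule vector_eq_rdot[THEN iffD1], rule allI)
  fix y
  have "(\<lambda>n. - inner ((T ^^ n) x) ((T ^^ n) (cJ y))) \<longlonglongrightarrow> - inner (A_op T x) (cJ y)"
    by (intro tendsto_minus inner_funpow_limit)
  moreover have "- inner ((T ^^ n) x) ((T ^^ n) (cJ y)) = inner ((T ^^ n) (cJ x)) ((T ^^ n) y)" for n
    by (simp add: funpow_cJ cblinD[OF contractionD(1)[OF T]] inner_cJ_left)
  ultimately have "(\<lambda>n. inner ((T ^^ n) (cJ x)) ((T ^^ n) y)) \<longlonglongrightarrow> inner (cJ (A_op T x)) y"
    by (simp add: inner_cJ_left)
  then show "inner (A_op T (cJ x)) y = inner (cJ (A_op T x)) y"
    by (rule LIMSEQ_unique[OF inner_funpow_limit])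
qed

lemmas pos_sqrt_A_op = pos_sqrt_properties[OF pos_op_A_op A_op_le]

lemma cblin_pos_sqrt_A_op: "cblin (pos_sqrt (A_op T))"
  unfolding cblin_def
  using pos_op_bounded_linear[OF pos_sqrt_A_op(1)] pos_sqrt_A_op(3)[OF bounded_linear_cJ] A_op_cJ
  by simp

text \<open>The squared norm of the root at \<open>x\<close> is \<open>inner (A_op T x) x\<close>,
  which is the limit of the squared orbit norms.\<close>

lemma norm_funpow_limit:
  "(\<lambda>n. norm ((T ^^ n) x)) \<longlonglongrightarrow> norm (pos_sqrt (A_op T) x)"
proof -
  have "inner (A_op T x) x = inner (pos_sqrt (A_op T) x) (pos_sqrt (A_op T) x)"
    by (metis pos_sqrt_A_op(1,2) pos_op_symmetric)
  with inner_funpow_limit[of x x]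
  have "(\<lambda>n. sqrt (inner ((T ^^ n) x) ((T ^^ n) x)))
      \<longlonglongrightarrow> sqrt (inner (pos_sqrt (A_op T) x) (pos_sqrt (A_op T) x))"
    by (intro tendsto_real_sqrt) simp
  then show ?thesis by (simp add: norm_eq_sqrt_inner)
qed

text \<open>In a dilation, \<open>E\<close> is isometric only on the closure of the range of
  \<open>A_op T\<close>. This inclusion ensures that \<open>X_T\<close> applies \<open>E\<close>
  only there.\<close>

lemma pos_sqrt_A_op_in_closure: "pos_sqrt (A_op T) x \<in> closure (range (A_op T))"
  using pos_op_range_subset_closure_range_square[OF pos_sqrt_A_op(1), of x]
  by (simp add: pos_sqrt_A_op(2))

lemma closure_range_A_op_subset: "closure (range (A_op T)) \<subseteq> closure (range (pos_sqrt (A_op T)))"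
  by (rule closure_mono) (metis image_subsetI pos_sqrt_A_op(2) rangeI)

end

section \<open>The commutant mapping\<close>

lemma continuous_eq_on_dense:
  fixes f g :: "'a::topological_space \<Rightarrow> 'b::t2_space"
  assumes "closure M = UNIV" "continuous_on UNIV f" "continuous_on UNIV g" "\<And>x. x \<in> M \<Longrightarrow> f x = g x"
  shows "f x = g x"
  using closure_minimal[OF _ closed_Collect_eq[OF assms(2,3)], of M] assms(1,4) by blast

lemma intertw_funpow:
  assumes "C \<in> intertw T T'"
  shows "C ((T ^^ n) x) = (T' ^^ n) (C x)"
proof -
  have "C (T x) = T' (C x)" for x
    using assms by (auto simp: intertw_def fun_eq_iff)
  then show ?thesis by (induction n) auto
qed

lemma commutant_eq_intertw: "commutant T = intertw T T"
  by (simp add: commutant_def intertw_def)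

text \<open>This isolates the properties of the pair \<open>W\<close>, \<open>X\<close> from which
  the commutant mapping is built. \<open>dense_span\<close> is minimality of the dilation, expressed
  through the range of \<open>X\<close>.\<close>

locale unitary_asymptote =
  fixes T :: "'a::chilbert \<Rightarrow> 'a" and W :: "'k::chilbert \<Rightarrow> 'k" and X :: "'a \<Rightarrow> 'k"
  assumes T: "bounded_linear T" and W: "cblin W" and norm_W: "\<And>x. norm (W x) = norm x"
    and surj_W: "surj W" and X: "cblin X"
    and norm_X: "\<And>x. (\<lambda>n. norm ((T ^^ n) x)) \<longlonglongrightarrow> norm (X x)"
    and W_X: "\<And>x. W (X x) = X (T x)"
    and dense_span: "closure (span (\<Union>n. (inv W ^^ n) ` closure (range X))) = UNIV"
begin

lemma W_inv: "W (inv W x) = x"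
  by (simp add: surj_W surj_f_inv_f)

lemma inj_W: "inj W"
proof (rule injI)
  fix x y assume "W x = W y"
  then have "norm (W (x - y)) = 0"
    using linear_diff[OF bounded_linear.linear[OF cblinD(1)[OF W]]] by simp
  then show "x = y" by (simp add: norm_W)
qed

lemma inv_W: "inv W (W x) = x"
  by (simp add: inj_W)

lemma norm_inv_W: "norm (inv W x) = norm x"
  using norm_W[of "inv W x"] by (simp add: W_inv)

lemma cblin_inv_W: "cblin (inv W)"
  unfolding cblin_def
proof
  interpret W: bounded_linear W by (rule cblinD[OF W])
  show "bounded_linear (inv W)"
  proof (rule bounded_linear_intro[of _ 1])
    show "inv W (x + y) = inv W x + inv W y" for x y
      by (rule injD[OF inj_W]) (simp add: W_inv W.add)
    show "inv W (r *\<^sub>R x) = r *\<^sub>R inv W x" for r x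
      by (rule injD[OF inj_W]) (simp add: W_inv W.scaleR)
    show "norm (inv W x) \<le> norm x * 1" for x
      by (simp add: norm_inv_W)
  qed
  have "inv W (cJ x) = cJ (inv W x)" for x
    by (rule injD[OF inj_W]) (simp add: W_inv cblinD(2)[OF W])
  then show "\<forall>x. inv W (cJ x) = cJ (inv W x)" by blast
qed

abbreviation U :: "nat \<Rightarrow> 'k \<Rightarrow> 'k" where "U n \<equiv> inv W ^^ n"

lemma bounded_linear_U: "bounded_linear (U n)"
  by (intro bounded_linear_funpow cblinD[OF cblin_inv_W])

lemma linear_U: "linear (U n)"
  by (rule bounded_linear.linear[OF bounded_linear_U])

lemma linear_X: "linear X"
  by (rule bounded_linear.linear[OF cblinD(1)[OF X]])

lemma norm_U: "norm (U n x) = norm x"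
  by (induction n) (auto simp: norm_inv_W)

text \<open>Since \<open>X T = W X\<close>, each additional power of \<open>T\<close> under
  \<open>X\<close> cancels one additional factor \<open>inv W\<close>.\<close>

lemma U_X_shift: "U (n + k) (X ((T ^^ k) x)) = U n (X x)"
proof (induction k)
  case (Suc k)
  have "U (n + Suc k) (X ((T ^^ Suc k) x)) = U (n + k) (inv W (X (T ((T ^^ k) x))))"
    by (simp add: funpow_swap1)
  also have "\<dots> = U (n + k) (X ((T ^^ k) x))"
    unfolding W_X[symmetric] inv_W ..
  finally show ?case using Suc by simp
qed simp

text \<open>Any two elements of the dense subspace have representations with a common exponent.\<close>

lemma U_X_common:
  shows "U n (X x) = U (n + k) (X ((T ^^ k) x))" "U k (X y) = U (n + k) (X ((T ^^ n) y))"
  using U_X_shift[of n k x] U_X_shift[of k n y] by (simp_all add: add.commute)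

text \<open>The ranges of \<open>U n\<close> after \<open>X\<close> increase with \<open>n\<close>
  by \<open>U_X_shift\<close>, so their union is already a subspace. Its closure contains every set
  in \<open>dense_span\<close>, hence also their span.\<close>

lemma dense: "closure (\<Union>n. range (\<lambda>x. U n (X x))) = UNIV" (is "closure ?M = _")
proof -
  have "subspace ?M"
  proof (rule subspaceI)
    have "0 = U 0 (X 0)" by (simp add: linear_0[OF linear_X])
    then show "0 \<in> ?M" by blast
    show "u + v \<in> ?M" if uv: "u \<in> ?M" "v \<in> ?M" for u v
    proof -
      obtain n x k y where u: "u = U n (X x)" and v: "v = U k (X y)" using uv by blast
      have "u + v = U (n + k) (X ((T ^^ k) x + (T ^^ n) y))"
        unfolding u v linear_add[OF linear_X] linear_add[OF linear_U] U_X_common[symmetric] ..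
      then show ?thesis by blast
    qed
    show "c *\<^sub>R u \<in> ?M" if u: "u \<in> ?M" for c u
    proof -
      obtain n x where u: "u = U n (X x)" using u by blast
      have "c *\<^sub>R u = U n (X (c *\<^sub>R x))"
        unfolding u linear_scale[OF linear_X] linear_scale[OF linear_U] ..
      then show ?thesis by blast
    qed
  qed
  then have sub: "subspace (closure ?M)" by (rule subspace_closure)
  have "U n ` closure (range X) \<subseteq> closure ?M" for n
  proof (rule image_closure_subset)
    show "continuous_on (closure (range X)) (U n)"
      by (rule linear_continuous_on[OF bounded_linear_U])
    have "U n ` range X \<subseteq> ?M" by blast
    then show "U n ` range X \<subseteq> closure ?M" using closure_subset by blast
  qed simp
  then have "span (\<Union>n. U n ` closure (range X)) \<subseteq> closure ?M"
    by (intro span_minimal sub) blast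
  then show ?thesis
    using closure_minimal[OF _ closed_closure] dense_span by blast
qed

lemma H0_iff: "x \<in> H0 T \<longleftrightarrow> X x = 0"
  using norm_X[of x] LIMSEQ_unique[OF norm_X[of x], of 0] by (auto simp: H0_def)

lemma commutant_inv_W:
  assumes "D \<in> commutant W"
  shows "D (U n z) = U n (D z)"
proof -
  have "D (W z) = W (D z)" for z
    using assms by (auto simp: commutant_def fun_eq_iff)
  then have "D (inv W z) = inv W (D z)" for z
    by (metis W_inv inv_W)
  then show ?thesis by (induction n) auto
qed

lemma commutant_lift_unique:
  assumes "D \<in> commutant W" "D' \<in> commutant W" "D \<circ> X = D' \<circ> X"
  shows "D = D'"
proof
  fix z
  show "D z = D' z"
  proof (rule continuous_eq_on_dense[OF dense, of D D'])
    show "continuous_on UNIV D" "continuous_on UNIV D'"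
      using assms by (auto simp: commutant_def cblin_def bounded_linear.linear linear_continuous_on)
    show "D z = D' z" if z: "z \<in> (\<Union>n. range (\<lambda>x. U n (X x)))" for z
      using z assms(3) by (auto simp: commutant_inv_W[OF assms(1)] commutant_inv_W[OF assms(2)] fun_eq_iff)
  qed
qed

text \<open>Since \<open>C\<close> commutes with the powers of \<open>T\<close>, its bound
  \<open>K\<close> applies to each vector of the orbit and survives the limit defining the norm of
  \<open>X\<close>.\<close>

lemma norm_X_commutant_le:
  assumes C: "C \<in> commutant T" and K: "\<And>x. norm (C x) \<le> norm x * K"
  shows "norm (X (C x)) \<le> norm (X x) * K"
proof (rule LIMSEQ_le[OF norm_X tendsto_mult_right[OF norm_X]])
  show "\<exists>N. \<forall>n\<ge>N. norm ((T ^^ n) (C x)) \<le> norm ((T ^^ n) x) * K"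
    using K intertw_funpow[OF C[unfolded commutant_eq_intertw]] by metis
qed

text \<open>A lift must send \<open>U n (X x)\<close> to \<open>U n (X (C x))\<close>. This
  prescription is Lipschitz on a dense subspace, so it extends continuously, and each algebraic law
  passes to the closure.\<close>

lemma commutant_lift_exists:
  assumes C: "C \<in> commutant T"
  shows "\<exists>D. D \<in> commutant W \<and> X \<circ> C = D \<circ> X"
proof -
  have Clin: "linear C" and CJ: "\<And>x. C (cJ x) = cJ (C x)" and CT: "\<And>x. C (T x) = T (C x)"
    using C by (auto simp: commutant_def cblin_def bounded_linear.linear fun_eq_iff)
  note CTn = intertw_funpow[OF C[unfolded commutant_eq_intertw]]
  obtain K where K0: "K \<ge> 0" and K: "\<And>x. norm (C x) \<le> norm x * K"
    using C bounded_linear.nonneg_bounded[of C] by (auto simp: commutant_def cblin_def)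
  note XC = norm_X_commutant_le[OF C K]
  let ?M = "\<Union>n. range (\<lambda>x. U n (X x))"
  \<comment> \<open>With a common exponent both differences become images of one vector
    \<open>z\<close> under isometries. When the right side is zero this is independence of the
    representation; in general it is the Lipschitz bound.\<close>
  have lip: "norm (U n (X (C x)) - U k (X (C y))) \<le> norm (U n (X x) - U k (X y)) * K" for n k x y
  proof -
    define z where "z = (T ^^ k) x - (T ^^ n) y"
    have eq: "U n (X x) - U k (X y) = U (n + k) (X z)"
      unfolding z_def linear_diff[OF linear_X] linear_diff[OF linear_U] U_X_common[symmetric] ..
    have eqC: "U n (X (C x)) - U k (X (C y)) = U (n + k) (X (C z))"
      unfolding z_def linear_diff[OF linear_X] linear_diff[OF linear_U] linear_diff[OF Clin] CTn
        U_X_common[symmetric] ..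
    show ?thesis unfolding eq eqC norm_U by (rule XC)
  qed
  have "\<exists>f. \<forall>n x. f (U n (X x)) = U n (X (C x))"
  proof (intro exI allI)
    fix n x
    let ?P = "\<lambda>v. \<exists>k y. U n (X x) = U k (X y) \<and> v = U k (X (C y))"
    show "(\<lambda>u. SOME v. \<exists>k y. u = U k (X y) \<and> v = U k (X (C y))) (U n (X x)) = U n (X (C x))"
    proof (rule some_equality)
      fix v assume "?P v"
      then obtain k y where "U n (X x) = U k (X y)" "v = U k (X (C y))" by blast
      with lip[of n x k y] show "v = U n (X (C x))" by simp
    qed blast
  qed
  then obtain f where f: "\<And>n x. f (U n (X x)) = U n (X (C x))" by blast
  have "uniformly_continuous_on ?M f"
    using lipschitz_on_uniformly_continuous[of K ?M f] K0 lip
    by (auto simp: lipschitz_on_def f dist_norm mult.commute)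
  then obtain D where "uniformly_continuous_on (closure ?M) D" and fD: "\<And>z. z \<in> ?M \<Longrightarrow> f z = D z"
    by (rule uniformly_continuous_on_extension_on_closure) (rule that)
  then have contD: "continuous_on UNIV D"
    by (metis dense uniformly_continuous_imp_continuous)
  then have contD': "continuous_on A (\<lambda>x. D (h x))" if "continuous_on A h" for A and h :: "'k \<Rightarrow> 'k"
    using continuous_on_compose2 that by blast
  have D: "D (U n (X x)) = U n (X (C x))" for n x
  proof -
    have "U n (X x) \<in> ?M" by blast
    then show ?thesis using fD f by metis
  qed
  have contW: "continuous_on UNIV W" and contJ: "continuous_on UNIV (cJ :: 'k \<Rightarrow> 'k)"
    using cblinD(1)[OF W] bounded_linear_cJ by (auto intro: linear_continuous_on)
  have D_add_M: "D (u + v) = D u + D v" if uv: "u \<in> ?M" "v \<in> ?M" for u v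
  proof -
    obtain n x k y where u: "u = U n (X x)" and v: "v = U k (X y)" using uv by blast
    have eq: "U n (X x) + U k (X y) = U (n + k) (X ((T ^^ k) x + (T ^^ n) y))" for x y
      unfolding linear_add[OF linear_X] linear_add[OF linear_U] U_X_common[symmetric] ..
    show ?thesis
      unfolding u v eq D using eq[of "C x" "C y"] by (simp add: linear_add[OF Clin] CTn)
  qed
  \<comment> \<open>Additivity is extended to the whole space one argument at a time.\<close>
  have D_add_1: "D (u + v) = D u + D v" if "u \<in> ?M" for u v
    by (rule continuous_eq_on_dense[OF dense, of "\<lambda>v. D (u + v)" "\<lambda>v. D u + D v"])
      (intro continuous_intros contD' contD D_add_M that | assumption)+
  have D_add: "D (u + v) = D u + D v" for u v
    by (rule continuous_eq_on_dense[OF dense, of "\<lambda>u. D (u + v)" "\<lambda>u. D u + D v"])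
      (intro continuous_intros contD' contD D_add_1 | assumption)+
  have D_scale: "D (c *\<^sub>R u) = c *\<^sub>R D u" for c u
  proof (rule continuous_eq_on_dense[OF dense, of "\<lambda>u. D (c *\<^sub>R u)" "\<lambda>u. c *\<^sub>R D u"])
    fix u assume "u \<in> ?M"
    then obtain n x where u: "u = U n (X x)" by blast
    show "D (c *\<^sub>R u) = c *\<^sub>R D u"
      unfolding u linear_scale[OF linear_U, symmetric] linear_scale[OF linear_X, symmetric] D
        linear_scale[OF Clin] ..
  qed (intro continuous_intros contD' contD)+
  have D_norm: "norm (D u) \<le> norm u * K" for u
  proof -
    have "norm (D u) - norm u * K \<le> 0"
    proof (rule continuous_le_on_closure[of ?M "\<lambda>u. norm (D u) - norm u * K" u 0])
      show "continuous_on (closure ?M) (\<lambda>u. norm (D u) - norm u * K)"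
        unfolding dense by (intro continuous_intros contD)
      show "u \<in> closure ?M" unfolding dense by simp
      show "norm (D u) - norm u * K \<le> 0" if u: "u \<in> ?M" for u
        using u XC by (auto simp: D norm_U)
    qed
    then show ?thesis by simp
  qed
  have D_J: "D (cJ u) = cJ (D u)" for u
  proof (rule continuous_eq_on_dense[OF dense, of "\<lambda>u. D (cJ u)" "\<lambda>u. cJ (D u)"])
    fix u assume "u \<in> ?M"
    then obtain n x where u: "u = U n (X x)" by blast
    show "D (cJ u) = cJ (D u)"
      unfolding u funpow_cJ[of "inv W", OF cblinD(2)[OF cblin_inv_W], symmetric] cblinD(2)[OF X, symmetric] D CJ ..
  qed (auto intro!: contD' contJ continuous_on_compose2[OF contJ contD])
  have D_W: "D (W u) = W (D u)" for u
  proof (rule continuous_eq_on_dense[OF dense, of "\<lambda>u. D (W u)" "\<lambda>u. W (D u)"])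
    fix u assume "u \<in> ?M"
    then obtain n x where u: "u = U n (X x)" by blast
    \<comment> \<open>Raising the exponent by one turns \<open>X x\<close> into
      \<open>X (T x)\<close> and exposes an \<open>inv W\<close> for \<open>W\<close> to
      cancel.\<close>
    have WU: "W (U n (X x)) = U n (X (T x))" for x
    proof -
      have "W (U n (X x)) = W (inv W (U n (X (T x))))"
        using U_X_shift[of n 1 x] by simp
      then show ?thesis by (simp add: W_inv)
    qed
    show "D (W u) = W (D u)"
      unfolding u WU D CT ..
  qed (auto intro!: contD' contW continuous_on_compose2[OF contW contD])
  have "cblin D"
    unfolding cblin_def using D_J bounded_linear_intro[OF D_add D_scale D_norm] by blast
  then have "D \<in> commutant W"
    by (auto simp: commutant_def D_W fun_eq_iff)
  moreover have "X \<circ> C = D \<circ> X"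
    using D[of 0] by (auto simp: fun_eq_iff)
  ultimately show ?thesis by blast
qed

text \<open>Two commuting operators have the same lift exactly when \<open>X\<close> kills their
  difference, that is, when the difference maps into the stable subspace, the kernel of
  \<open>X\<close>.\<close>

lemma commutant_map_inj_iff:
  "inj_on (\<lambda>C. THE D. D \<in> commutant W \<and> X \<circ> C = D \<circ> X) (commutant T) \<longleftrightarrow>
     (\<forall>C\<in>commutant T. range C \<subseteq> H0 T \<longrightarrow> C = (\<lambda>_. 0))"
  (is "inj_on ?\<gamma> _ \<longleftrightarrow> ?R")
proof
  assume inj: "inj_on ?\<gamma> (commutant T)"
  have 0: "(\<lambda>_. 0) \<in> commutant T"
    by (auto simp: commutant_def cblin_def fun_eq_iff linear_0[OF bounded_linear.linear[OF T]] cJ_0)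
  show ?R
  proof (intro ballI impI)
    fix C assume C: "C \<in> commutant T" "range C \<subseteq> H0 T"
    then have "X (C x) = 0" for x
      using H0_iff by blast
    then have "X \<circ> C = X \<circ> (\<lambda>_. 0)"
      by (simp add: fun_eq_iff linear_0[OF linear_X])
    then have "?\<gamma> C = ?\<gamma> (\<lambda>_. 0)" by simp
    from inj_onD[OF inj this C(1) 0] show "C = (\<lambda>_. 0)" .
  qed
next
  assume R: ?R
  have lift: "X \<circ> C = ?\<gamma> C \<circ> X" if "C \<in> commutant T" for C
  proof -
    have "\<exists>!D. D \<in> commutant W \<and> X \<circ> C = D \<circ> X"
      using commutant_lift_exists[OF that] commutant_lift_unique by metis
    from theI'[OF this] show ?thesis by blast
  qed
  show "inj_on ?\<gamma> (commutant T)"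
  proof (rule inj_onI)
    fix C C' assume C: "C \<in> commutant T" and C': "C' \<in> commutant T" and eq: "?\<gamma> C = ?\<gamma> C'"
    have "X \<circ> C = ?\<gamma> C \<circ> X" by (rule lift[OF C])
    also have "\<dots> = ?\<gamma> C' \<circ> X" by (simp only: eq)
    also have "\<dots> = X \<circ> C'" by (rule lift[OF C', symmetric])
    finally have "X (C x) = X (C' x)" for x
      by (simp add: fun_eq_iff)
    then have "range (\<lambda>x. C x - C' x) \<subseteq> H0 T"
      by (auto simp: H0_iff linear_diff[OF linear_X])
    moreover have "(\<lambda>x. C x - C' x) \<in> commutant T"
      using C C' linear_diff[OF bounded_linear.linear[OF T]]
      by (auto simp: commutant_def cblin_def fun_eq_iff cJ_diff intro!: bounded_linear_sub)
    ultimately have "(\<lambda>x. C x - C' x) = (\<lambda>_. 0)" using R by blast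
    then show "C = C'" by (simp add: fun_eq_iff)
  qed
qed

end

section \<open>From a minimal unitary dilation to a unitary asymptote\<close>

lemma unitary_asymptote_X_T:
  assumes T: "contraction T" and dil: "W_T_dilation T W E"
  shows "unitary_asymptote T W (X_T T E)"
proof -
  define L S where "L = closure (range (A_op T))" and "S = pos_sqrt (A_op T)"
  obtain V where V: "\<And>x. S (T x) = V (S x)" and min: "min_unitary_dilation V L W E"
    using dil unfolding W_T_dilation_def Let_def L_def S_def by blast
  have W: "cblin W" "\<And>x. norm (W x) = norm x" "surj W" and E: "cblin E"
    and isom: "\<And>x y. x \<in> L \<Longrightarrow> y \<in> L \<Longrightarrow> inner (E x) (E y) = inner x y"
    and ext: "\<And>x. x \<in> L \<Longrightarrow> W (E x) = E (V x)"
    and span: "closure (span (\<Union>n. (inv W ^^ n) ` (E ` L))) = UNIV"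
    using min unfolding min_unitary_dilation_def by blast+
  have SL: "S x \<in> L" for x
    unfolding S_def L_def by (rule pos_sqrt_A_op_in_closure[OF T])
  have X: "X_T T E = (\<lambda>x. E (S x))"
    by (auto simp: X_T_def S_def)
  show ?thesis
    unfolding X
  proof (rule unitary_asymptote.intro)
    show "bounded_linear T" by (rule contractionD[OF T])
    show "cblin (\<lambda>x. E (S x))"
      unfolding S_def by (rule cblin_compose[OF E cblin_pos_sqrt_A_op[OF T]])
    show "W (E (S x)) = E (S (T x))" for x
      by (simp add: ext[OF SL] V)
    show "(\<lambda>n. norm ((T ^^ n) x)) \<longlonglongrightarrow> norm (E (S x))" for x
    proof -
      have "norm (E (S x)) = norm (S x)"
        by (simp add: norm_eq_sqrt_inner isom SL)
      then show ?thesis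
        using norm_funpow_limit[OF T, of x] by (simp add: S_def)
    qed
    have "E ` closure (range S) \<subseteq> closure (range (\<lambda>x. E (S x)))"
      by (rule image_closure_subset[OF linear_continuous_on[OF cblinD(1)[OF E]] closed_closure])
        (use closure_subset[of "range (\<lambda>x. E (S x))"] in blast)
    then have "E ` L \<subseteq> closure (range (\<lambda>x. E (S x)))"
      using closure_range_A_op_subset[OF T] unfolding L_def S_def by blast
    then have "span (\<Union>n. (inv W ^^ n) ` (E ` L))
        \<subseteq> span (\<Union>n. (inv W ^^ n) ` closure (range (\<lambda>x. E (S x))))"
      by (intro span_mono UN_mono image_mono) auto
    from closure_mono[OF this]
    show "closure (span (\<Union>n. (inv W ^^ n) ` closure (range (\<lambda>x. E (S x))))) = UNIV"
      unfolding span by blast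
  qed (fact W)+
qed

section \<open>Intertwiners into the stable subspace\<close>

text \<open>One direction of \<open>stable_relation\<close>, as a condition on an ordered pair. With
  both arguments equal it becomes the injectivity criterion, so all three claims are about a single
  relation.\<close>

definition no_stable_intertwiner ::
  "('a::chilbert \<Rightarrow> 'a) \<Rightarrow> ('b::chilbert \<Rightarrow> 'b) \<Rightarrow> bool" where
  "no_stable_intertwiner T T' \<longleftrightarrow>
     (\<forall>C\<in>intertw T T'. range C \<subseteq> H0 T' \<longrightarrow> C = (\<lambda>_. 0))"

lemma no_stable_intertwinerD:
  assumes "no_stable_intertwiner T T'" "C \<in> intertw T T'" "\<And>x. C x \<in> H0 T'"
  shows "C x = 0"
  using assms unfolding no_stable_intertwiner_def by (metis image_subsetI)

lemma no_stable_intertwinerI: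
  assumes "\<And>C x. C \<in> intertw T T' \<Longrightarrow> (\<And>x. C x \<in> H0 T') \<Longrightarrow> C x = 0"
  shows "no_stable_intertwiner T T'"
  unfolding no_stable_intertwiner_def using assms by blast

lemma stable_relation_iff:
  "stable_relation T T' \<longleftrightarrow> no_stable_intertwiner T T' \<and> no_stable_intertwiner T' T"
  by (simp add: stable_relation_def no_stable_intertwiner_def)

text \<open>The criterion on the right mentions neither \<open>W\<close> nor \<open>E\<close>, so
  the remaining arguments concern only intertwiners.\<close>

theorem gamma_injective_iff:
  assumes "contraction T" "W_T_dilation T W E"
  shows "gamma_injective T W E \<longleftrightarrow> no_stable_intertwiner T T"
proof -
  interpret unitary_asymptote T W "X_T T E" by (rule unitary_asymptote_X_T[OF assms])
  show ?thesis
    using commutant_map_inj_iff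
    unfolding gamma_injective_def gamma_def[abs_def] no_stable_intertwiner_def commutant_eq_intertw .
qed

lemma intertw_iff: "C \<in> intertw T T' \<longleftrightarrow> cblin C \<and> (\<forall>x. C (T x) = T' (C x))"
  by (auto simp: intertw_def fun_eq_iff)

lemma intertw_compose:
  "C \<in> intertw T' T'' \<Longrightarrow> D \<in> intertw T T' \<Longrightarrow> (\<lambda>x. C (D x)) \<in> intertw T T''"
  by (simp add: intertw_iff cblin_compose)

lemma H0_iff_tendsto: "x \<in> H0 T \<longleftrightarrow> (\<lambda>n. (T ^^ n) x) \<longlonglongrightarrow> 0"
  by (simp add: H0_def tendsto_norm_zero_iff)

lemma intertw_H0:
  assumes "C \<in> intertw T T'" "x \<in> H0 T"
  shows "C x \<in> H0 T'"
proof -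
  interpret C: bounded_linear C using assms(1) by (simp add: intertw_iff cblin_def)
  show ?thesis
    using C.tendsto_zero[of "\<lambda>n. (T ^^ n) x"] assms(2)
    by (simp add: H0_iff_tendsto intertw_funpow[OF assms(1)])
qed

section \<open>Invariance under quasisimilarity\<close>

lemma quasisimilar_sym: "quasisimilar T T' \<Longrightarrow> quasisimilar T' T"
  unfolding quasisimilar_def by blast

text \<open>For \<open>C\<close> commuting with \<open>T'\<close>, the product \<open>Y C X\<close>
  commutes with \<open>T\<close> and maps into its stable subspace, hence vanishes. Injectivity of
  \<open>Y\<close> and density of the range of \<open>X\<close> then give
  \<open>C = 0\<close>.\<close>

lemma quasisimilar_no_stable_intertwiner:
  assumes "quasisimilar T T'" and nsi: "no_stable_intertwiner T T"
  shows "no_stable_intertwiner T' T'"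
proof (rule no_stable_intertwinerI)
  fix C y assume C: "C \<in> intertw T' T'" and C0: "\<And>y. C y \<in> H0 T'"
  obtain X Y where X: "X \<in> intertw T T'" "closure (range X) = UNIV"
    and Y: "Y \<in> intertw T' T" "inj Y"
    using assms(1) unfolding quasisimilar_def quasiaffinity_def by blast
  have "Y (C (X x)) = 0" for x
    by (rule no_stable_intertwinerD[OF nsi, of "\<lambda>x. Y (C (X x))"])
      (intro intertw_compose[OF Y(1) intertw_compose[OF C X(1)]] intertw_H0[OF Y(1) C0])+
  moreover have "Y 0 = 0"
    using Y(1) by (simp add: intertw_iff cblin_def bounded_linear.linear linear_0)
  ultimately have CX: "C (X x) = 0" for x
    using injD[OF Y(2)] by metis
  have "continuous_on UNIV C"
    using C by (simp add: intertw_iff cblin_def linear_continuous_on)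
  then show "C y = 0"
    by (rule continuous_eq_on_dense[OF X(2) _ continuous_on_const]) (use CX in auto)
qed

section \<open>Direct sums\<close>

lemma dsum_funpow: "(dsum T T' ^^ n) (x, y) = ((T ^^ n) x, (T' ^^ n) y)"
  by (induction n) (auto simp: dsum_def)

lemma H0_dsum: "(x, y) \<in> H0 (dsum T T') \<longleftrightarrow> x \<in> H0 T \<and> y \<in> H0 T'"
  unfolding H0_iff_tendsto dsum_funpow
  using tendsto_fst[of "\<lambda>n. ((T ^^ n) x, (T' ^^ n) y)" 0 sequentially]
    tendsto_snd[of "\<lambda>n. ((T ^^ n) x, (T' ^^ n) y)" 0 sequentially]
    tendsto_Pair[of "\<lambda>n. (T ^^ n) x" 0 sequentially "\<lambda>n. (T' ^^ n) y" 0]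
  by (auto simp: zero_prod_def)

lemma contraction_dsum:
  assumes "contraction T" "contraction T'"
  shows "contraction (dsum T T')"
  unfolding contraction_def cblin_def
proof (intro conjI allI)
  have eq: "dsum T T' = (\<lambda>z. (T (fst z), T' (snd z)))"
    by (auto simp: dsum_def fun_eq_iff)
  show "bounded_linear (dsum T T')"
    unfolding eq using contractionD(2)[OF assms(1)] contractionD(2)[OF assms(2)]
    by (intro bounded_linear_Pair bounded_linear_compose[OF _ bounded_linear_fst]
        bounded_linear_compose[OF _ bounded_linear_snd])
  show "dsum T T' (cJ z) = cJ (dsum T T' z)" for z
    using cblinD(2)[OF contractionD(1)[OF assms(1)]] cblinD(2)[OF contractionD(1)[OF assms(2)]]
    by (simp add: eq cJ_prod_def case_prod_beta)
  show "norm (dsum T T' z) \<le> norm z" for z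
    unfolding eq norm_prod_def fst_conv snd_conv
    using contractionD(3)[OF assms(1)] contractionD(3)[OF assms(2)]
    by (intro real_sqrt_le_mono add_mono power_mono) auto
qed

lemma cblin_Pair: "cblin f \<Longrightarrow> cblin g \<Longrightarrow> cblin (\<lambda>x. (f x, g x))"
  by (auto simp: cblin_def cJ_prod_def bounded_linear_Pair)

lemma cblin_ident: "cblin (\<lambda>x. x)" and cblin_zero: "cblin (\<lambda>x. 0)"
  and cblin_fst: "cblin fst" and cblin_snd: "cblin snd"
  by (auto simp: cblin_def cJ_0 cJ_prod_def case_prod_beta bounded_linear_ident
      bounded_linear_fst bounded_linear_snd)

context
  fixes A :: "'a::chilbert \<Rightarrow> 'a" and B :: "'b::chilbert \<Rightarrow> 'b"
  assumes A: "contraction A" and B: "contraction B"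
begin

lemma intertw_dsum:
  shows "fst \<in> intertw (dsum A B) A" "snd \<in> intertw (dsum A B) B"
    "(\<lambda>x. (x, 0)) \<in> intertw A (dsum A B)" "(\<lambda>y. (0, y)) \<in> intertw B (dsum A B)"
  by (auto simp: intertw_iff dsum_def contraction_0[OF A] contraction_0[OF B] cblin_fst cblin_snd cblin_Pair cblin_ident cblin_zero)

text \<open>Composing with a coordinate projection extends an intertwiner from a summand to the sum.
  Conversely, an intertwiner on the sum is determined by its restrictions to the summands.\<close>

lemma no_stable_intertwiner_dsum_left:
  "no_stable_intertwiner (dsum A B) R \<longleftrightarrow> no_stable_intertwiner A R \<and> no_stable_intertwiner B R"
proof (intro iffI conjI; (elim conjE)?)
  assume nsi: "no_stable_intertwiner (dsum A B) R"
  show "no_stable_intertwiner A R"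
  proof (rule no_stable_intertwinerI)
    fix C x assume "C \<in> intertw A R" "\<And>x. C x \<in> H0 R"
    then show "C x = 0"
      using no_stable_intertwinerD[OF nsi intertw_compose[OF _ intertw_dsum(1)], of C "(x, 0)"] by simp
  qed
  show "no_stable_intertwiner B R"
  proof (rule no_stable_intertwinerI)
    fix C x assume "C \<in> intertw B R" "\<And>x. C x \<in> H0 R"
    then show "C x = 0"
      using no_stable_intertwinerD[OF nsi intertw_compose[OF _ intertw_dsum(2)], of C "(0, x)"] by simp
  qed
next
  assume nsi: "no_stable_intertwiner A R" "no_stable_intertwiner B R"
  show "no_stable_intertwiner (dsum A B) R"
  proof (rule no_stable_intertwinerI)
    fix C and z :: "'a \<times> 'b" assume C: "C \<in> intertw (dsum A B) R" "\<And>x. C x \<in> H0 R"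
    have "C (fst z, 0) = 0"
      by (rule no_stable_intertwinerD[OF nsi(1) intertw_compose[OF C(1) intertw_dsum(3)] C(2)])
    moreover have "C (0, snd z) = 0"
      by (rule no_stable_intertwinerD[OF nsi(2) intertw_compose[OF C(1) intertw_dsum(4)] C(2)])
    moreover have "linear C"
      using C(1) by (simp add: intertw_iff cblin_def bounded_linear.linear)
    ultimately have "C ((fst z, 0) + (0, snd z)) = 0"
      by (simp add: linear_add del: add_Pair)
    then show "C z = 0" by simp
  qed
qed

text \<open>Here inclusions and projections act after the intertwiner; being intertwiners
  themselves, they preserve stable subspaces by \<open>intertw_H0\<close>.\<close>

lemma no_stable_intertwiner_dsum_right:
  "no_stable_intertwiner R (dsum A B) \<longleftrightarrow> no_stable_intertwiner R A \<and> no_stable_intertwiner R B"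
proof (intro iffI conjI; (elim conjE)?)
  assume nsi: "no_stable_intertwiner R (dsum A B)"
  show "no_stable_intertwiner R A"
  proof (rule no_stable_intertwinerI)
    fix C x assume C: "C \<in> intertw R A" "\<And>x. C x \<in> H0 A"
    from no_stable_intertwinerD[OF nsi intertw_compose[OF intertw_dsum(3) C(1)]
        intertw_H0[OF intertw_dsum(3) C(2)], of x]
    show "C x = 0" by (simp add: zero_prod_def)
  qed
  show "no_stable_intertwiner R B"
  proof (rule no_stable_intertwinerI)
    fix C x assume C: "C \<in> intertw R B" "\<And>x. C x \<in> H0 B"
    from no_stable_intertwinerD[OF nsi intertw_compose[OF intertw_dsum(4) C(1)]
        intertw_H0[OF intertw_dsum(4) C(2)], of x]
    show "C x = 0" by (simp add: zero_prod_def)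
  qed
next
  assume nsi: "no_stable_intertwiner R A" "no_stable_intertwiner R B"
  show "no_stable_intertwiner R (dsum A B)"
  proof (rule no_stable_intertwinerI)
    fix C x assume C: "C \<in> intertw R (dsum A B)" "\<And>x. C x \<in> H0 (dsum A B)"
    have "fst (C x) = 0"
      by (rule no_stable_intertwinerD[OF nsi(1) intertw_compose[OF intertw_dsum(1) C(1)]
            intertw_H0[OF intertw_dsum(1) C(2)]])
    moreover have "snd (C x) = 0"
      by (rule no_stable_intertwinerD[OF nsi(2) intertw_compose[OF intertw_dsum(2) C(1)]
            intertw_H0[OF intertw_dsum(2) C(2)]])
    ultimately show "C x = 0" by (simp add: prod_eq_iff)
  qed
qed

end

theorem mainTheorem14:
  fixes T :: "'a::chilbert \<Rightarrow> 'a" and T' :: "'b::chilbert \<Rightarrow> 'b"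
    and W1 :: "'k1::chilbert \<Rightarrow> 'k1" and E1 :: "'a \<Rightarrow> 'k1"
    and W2 :: "'k2::chilbert \<Rightarrow> 'k2" and E2 :: "'b \<Rightarrow> 'k2"
    and W3 :: "'k3::chilbert \<Rightarrow> 'k3" and E3 :: "'a \<times> 'b \<Rightarrow> 'k3"
    and W4 :: "'k4::chilbert \<Rightarrow> 'k4" and E4 :: "'a \<times> 'a \<Rightarrow> 'k4"
  assumes "contraction T" and "contraction T'"
    and "W_T_dilation T W1 E1" and "W_T_dilation T' W2 E2"
    and "W_T_dilation (dsum T T') W3 E3" and "W_T_dilation (dsum T T) W4 E4"
  shows "(quasisimilar T T' \<longrightarrow> (gamma_injective T W1 E1 \<longleftrightarrow> gamma_injective T' W2 E2))
       \<and> (gamma_injective (dsum T T') W3 E3 \<longleftrightarrow>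
            gamma_injective T W1 E1 \<and> gamma_injective T' W2 E2 \<and> stable_relation T T')
       \<and> (gamma_injective (dsum T T) W4 E4 \<longleftrightarrow> gamma_injective T W1 E1)"
proof -
  note [simp] = gamma_injective_iff[OF assms(1,3)] gamma_injective_iff[OF assms(2,4)]
    gamma_injective_iff[OF contraction_dsum[OF assms(1,2)] assms(5)]
    gamma_injective_iff[OF contraction_dsum[OF assms(1,1)] assms(6)]
  \<comment> \<open>Splitting both arguments for \<open>dsum T T'\<close> yields four conditions:
    the diagonal ones are injectivity for \<open>T\<close> and \<open>T'\<close>, the off-diagonal
    ones are the stable relation. For \<open>dsum T T\<close> all four coincide.\<close>
  show ?thesis
    using quasisimilar_no_stable_intertwiner[of T T'] quasisimilar_no_stable_intertwiner[of T' T]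
      quasisimilar_sym[of T T']
    by (auto simp: no_stable_intertwiner_dsum_left no_stable_intertwiner_dsum_right
        stable_relation_iff assms(1,2))
qed

end
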